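(* Let $n\ge1$ and let $S\subset\mathbb{R}^{n+1}$ be a compact $C^2$ hypersurface bounding a convex domain. Let $\nu$ denote Euclidean surface measure on $S$ and let $\psi$ be a real-valued $C^1$ function defined on a neighborhood of $S$ in $\mathbb{R}^{n+1}$. Suppose $0<\alpha<1$. 1. If there exists a $C>0$ for which $a(v,t)\le C|t|^{-\alpha}$ for all directions $v$ and all real $t\neq0$, then there exists a constant $C'$ depending on $S$, $\psi$ and $\alpha$ such that $|\widehat{\psi\nu}(\lambda)|\le C'|\lambda|^{-\alpha}$ for all $\lambda\in\mathbb{R}^{n+1}$, $\lambda\ne0$. 2. Conversely, suppose $\psi(x)>0$ for all $x\in S$. If there is a constant $C'$ such that $|\widehat{\psi\nu}(\lambda)|\le C'|\lambda|^{-\alpha}$ for all $\lambda\in\mathbb{R}^{n+1}$, $\lambda\neq0$, then there exists a $C>0$ depending on $S$ and $\alpha$ for which $a(v,t)\le C|t|^{-\alpha}$ for all directions $v$ and all real $t\ne0$.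
   Context: A direction is a vector $v\in\mathbb{R}^{n+1}$ with $|v|=1$. For a direction $v$ and real $t\neq0$, $$a(v,t)=\sup_{s\in\mathbb{R}}\nu\big(\{x\in S : s\le x\cdot v\le s+|t|^{-1}\}\big),$$ the maximal surface measure of the intersection of $S$ with a slab of width $|t|^{-1}$ perpendicular to $v$. The Fourier transform is $$\widehat{\psi\nu}(\lambda)=\int_S e^{-i\lambda\cdot x}\,\psi(x)\,d\nu(x),\qquad \lambda\in\mathbb{R}^{n+1}.$$ "$S$ bounds a convex domain" means that $S$ is the boundary of a bounded open convex set in $\mathbb{R}^{n+1}$. *)

theory Defs
  imports "HOL-Analysis.Analysis"
begin

definition C1_on :: "('a::real_normed_vector \<Rightarrow> 'b::real_normed_vector) \<Rightarrow> 'a set \<Rightarrow> bool"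
  where "C1_on f U \<longleftrightarrow>
    (\<exists>f' :: 'a \<Rightarrow> 'a \<Rightarrow>\<^sub>L 'b.
      (\<forall>x\<in>U. (f has_derivative blinfun_apply (f' x)) (at x)) \<and> continuous_on U f')"

definition C2_on :: "('a::real_normed_vector \<Rightarrow> 'b::real_normed_vector) \<Rightarrow> 'a set \<Rightarrow> bool"
  where "C2_on f U \<longleftrightarrow>
    (\<exists>f' :: 'a \<Rightarrow> 'a \<Rightarrow>\<^sub>L 'b.
      (\<forall>x\<in>U. (f has_derivative blinfun_apply (f' x)) (at x)) \<and> C1_on f' U)"

text \<open>
  The type \<open>real ^ ('n + 1)\<close> is (n+1)-dimensional Euclidean space, where n is the cardinality
  of the finite index type \<open>'n\<close> (hence at least 1) and \<open>1\<close> is the one-element type.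

  A hypersurface is an embedded submanifold of codimension one, described by its local
  parametrizations over open sets of n-dimensional space.
\<close>

definition C2_patch ::
    "(real ^ ('n::finite + 1)) set \<Rightarrow> (real ^ 'n) set \<Rightarrow> (real ^ 'n \<Rightarrow> real ^ ('n + 1)) \<Rightarrow> bool"
  where "C2_patch S U \<phi> \<longleftrightarrow>
    open U \<and> C2_on \<phi> U \<and>
    (\<forall>y\<in>U. inj (frechet_derivative \<phi> (at y))) \<and>
    openin (top_of_set S) (\<phi> ` U) \<and>
    (\<exists>\<rho>. homeomorphism U (\<phi> ` U) \<phi> \<rho>)"

definition C2_hypersurface :: "(real ^ ('n::finite + 1)) set \<Rightarrow> bool"
  where "C2_hypersurface S \<longleftrightarrow> (\<forall>p\<in>S. \<exists>U \<phi>. C2_patch S U \<phi> \<and> p \<in> \<phi> ` U)"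

definition bounds_convex_domain :: "'a::euclidean_space set \<Rightarrow> bool"
  where "bounds_convex_domain S \<longleftrightarrow>
    (\<exists>\<Omega>. open \<Omega> \<and> bounded \<Omega> \<and> convex \<Omega> \<and> S = frontier \<Omega>)"

definition area_element :: "(real ^ 'n::finite \<Rightarrow> real ^ ('n + 1)) \<Rightarrow> real ^ 'n \<Rightarrow> real"
  where "area_element \<phi> y =
    (let J = matrix (frechet_derivative \<phi> (at y)) in sqrt (det (transpose J ** J)))"

text \<open>
  Euclidean surface measure on \<open>S\<close>, viewed as a Borel measure on the ambient space that is
  carried by \<open>S\<close>.  In every local parametrization it is the area element times Lebesgue measure;
  since countably many patches cover a hypersurface, this determines the measure.
\<close>

definition surface_measure_on ::
    "(real ^ ('n::finite + 1)) set \<Rightarrow> (real ^ ('n + 1)) measure \<Rightarrow> bool"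
  where "surface_measure_on S \<nu> \<longleftrightarrow>
    sets \<nu> = sets borel \<and>
    emeasure \<nu> (- S) = 0 \<and>
    (\<forall>U \<phi>. C2_patch S U \<phi> \<longrightarrow>
      (\<forall>A\<in>sets borel. A \<subseteq> \<phi> ` U \<longrightarrow>
        emeasure \<nu> A =
          (\<integral>\<^sup>+y\<in>U. (ennreal (area_element \<phi> y) * indicator A (\<phi> y)) \<partial>lborel)))"

text \<open>
  The slab maximum \<open>a(v,t)\<close>.  It takes values in \<open>ennreal\<close>, so that the supremum is meaningful
  without a prior proof that \<open>\<nu>\<close> is finite.
\<close>

definition slab_sup ::
    "'a::euclidean_space measure \<Rightarrow> 'a set \<Rightarrow> 'a \<Rightarrow> real \<Rightarrow> ennreal"
  where "slab_sup \<nu> S v t =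
    (SUP s::real. emeasure \<nu> {x \<in> S. s \<le> x \<bullet> v \<and> x \<bullet> v \<le> s + inverse \<bar>t\<bar>})"

definition fourier_transform ::
    "'a::euclidean_space measure \<Rightarrow> 'a set \<Rightarrow> ('a \<Rightarrow> real) \<Rightarrow> 'a \<Rightarrow> complex"
  where "fourier_transform \<nu> S \<psi> \<xi> =
    (LINT x:S|\<nu>. exp (- (\<i> * complex_of_real (\<xi> \<bullet> x))) * complex_of_real (\<psi> x))"

text \<open>
  The function \<open>\<psi>\<close> is total; its values outside some neighbourhood of \<open>S\<close> are irrelevant.
\<close>

definition C1_near :: "('a::euclidean_space \<Rightarrow> real) \<Rightarrow> 'a set \<Rightarrow> bool"
  where "C1_near \<psi> S \<longleftrightarrow> (\<exists>N. open N \<and> S \<subseteq> N \<and> C1_on \<psi> N)"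

end

theory Submission
  imports Defs
begin

text \<open>
  In a chart that is a graph over a hyperplane every phase \<open>x \<bullet> v\<close> is affine in all coordinates
  but one, so it is a convex function \<open>f\<close> up to sign.  Scaling about the minimum \<open>z\<close> of \<open>f\<close> and
  averaging over the scales \<open>1 \<le> s \<le> 2\<close> turns the oscillatory integral into an integral of
  one-dimensional ones along rays, where convexity bounds the radial derivative from below by
  \<open>f y - f z\<close>.  Integrating by parts along the rays leaves the integral of
  \<open>min 1 (1 / (T * (f y - f z)))\<close>, with \<open>T\<close> the frequency, whose sublevel sets are slabs of the
  surface; for \<open>\<alpha> < 1\<close> the dyadic sum over these slabs is of order \<open>T powr (- \<alpha>)\<close>.

  Conversely, the indicator of a slab is dominated by a multiple of a Fejer kernel, which is an
  average over \<open>0 \<le> \<tau> \<le> 1\<close> of characters in the direction \<open>v\<close>; the decay of the Fourier transform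
  is integrable in \<open>\<tau>\<close> because \<open>\<alpha> < 1\<close>.
\<close>

subsection \<open>Continuously differentiable maps\<close>

text \<open>Convexity replaces it. Along a single ray it makes the derivative of the phase monotone,
  so integration by parts needs only a lower bound for that derivative, and the slab hypothesis
  measures the set where this bound is poor. Scales in [1,2] stay away from 0, where the radial
  derivative may vanish; the Jacobian is at most 2^n there. The minimum \<open>z\<close> is taken
  over a compact ball \<open>K\<close> inside the chart and may lie on its boundary. This does no
  harm: \<open>K\<close> is convex, so a ray from \<open>z\<close> meets it in an interval, whose
  end points only contribute boundary terms. The localising radii are fixed before \<psi>. The same
  covering yields finiteness of \<open>emeasure \<nu> S\<close>, which the description of \<nu> by
  patches does not state and which the converse uses for Fubini.\<close>

lemma C1_on_subset: "C1_on f U \<Longrightarrow> V \<subseteq> U \<Longrightarrow> C1_on f V"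
  unfolding C1_on_def by (meson continuous_on_subset subsetD)

lemma C1_on_cong:
  assumes "C1_on f U" "open U" "\<And>x. x \<in> U \<Longrightarrow> f x = g x"
  shows "C1_on g U"
proof -
  obtain f' where f': "\<And>x. x \<in> U \<Longrightarrow> (f has_derivative blinfun_apply (f' x)) (at x)" "continuous_on U f'"
    using assms(1) unfolding C1_on_def by blast
  have "(g has_derivative blinfun_apply (f' x)) (at x)" if "x \<in> U" for x
    by (rule has_derivative_transform_within_open[OF f'(1)[OF that] assms(2) that assms(3)])
  then show ?thesis unfolding C1_on_def using f'(2) by (intro exI[of _ f']) simp
qed

lemma C1_on_imp_differentiable: "C1_on f U \<Longrightarrow> x \<in> U \<Longrightarrow> f differentiable (at x)"
  unfolding C1_on_def differentiable_def by blast

lemma C1_on_imp_continuous_on: "C1_on f U \<Longrightarrow> continuous_on U f"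
  by (meson C1_on_imp_differentiable continuous_at_imp_continuous_on differentiable_imp_continuous_within)

lemma C1_on_const: "C1_on (\<lambda>x. c) U"
  unfolding C1_on_def by (intro exI[of _ "\<lambda>x. 0"]) (auto simp: zero_blinfun.rep_eq)

lemma C1_on_compose:
  assumes f: "C1_on f U" and g: "C1_on g V" and sub: "f ` U \<subseteq> V"
  shows "C1_on (\<lambda>x. g (f x)) U"
proof -
  obtain f' where f': "\<And>x. x \<in> U \<Longrightarrow> (f has_derivative blinfun_apply (f' x)) (at x)" "continuous_on U f'"
    using f unfolding C1_on_def by blast
  obtain g' where g': "\<And>x. x \<in> V \<Longrightarrow> (g has_derivative blinfun_apply (g' x)) (at x)" "continuous_on V g'"
    using g unfolding C1_on_def by blast
  have "((\<lambda>x. g (f x)) has_derivative blinfun_apply (g' (f x) o\<^sub>L f' x)) (at x)" if "x \<in> U" for x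
    using diff_chain_at[OF f'(1)[OF that] g'(1)[of "f x"]] sub that
    by (auto simp: o_def blinfun_compose.rep_eq)
  moreover have "continuous_on U (\<lambda>x. g' (f x) o\<^sub>L f' x)"
    by (intro continuous_intros f'(2) continuous_on_compose2[OF g'(2)] C1_on_imp_continuous_on[OF f] sub)
  ultimately show ?thesis
    unfolding C1_on_def by (intro exI[of _ "\<lambda>x. g' (f x) o\<^sub>L f' x"]) auto
qed

lemma C1_on_bounded_linear: "bounded_linear h \<Longrightarrow> C1_on h U"
  unfolding C1_on_def
  by (rule exI[of _ "\<lambda>x. Blinfun h"])
     (auto simp: bounded_linear_Blinfun_apply intro: bounded_linear_imp_has_derivative)

lemma C1_on_linear_compose:
  assumes "bounded_linear h" "C1_on f U"
  shows "C1_on (\<lambda>x. h (f x)) U"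
  using C1_on_compose[OF assms(2) C1_on_bounded_linear[OF assms(1), of UNIV]] by simp

lemma C1_on_bilinear:
  assumes h: "bounded_bilinear h" and f: "C1_on f U" and g: "C1_on g U"
  shows "C1_on (\<lambda>x. h (f x) (g x)) U"
proof -
  interpret bounded_bilinear h by fact
  obtain f' where f': "\<And>x. x \<in> U \<Longrightarrow> (f has_derivative blinfun_apply (f' x)) (at x)" "continuous_on U f'"
    using f unfolding C1_on_def by blast
  obtain g' where g': "\<And>x. x \<in> U \<Longrightarrow> (g has_derivative blinfun_apply (g' x)) (at x)" "continuous_on U g'"
    using g unfolding C1_on_def by blast
  define D where "D x = (prod_right (f x) o\<^sub>L g' x) + (prod_left (g x) o\<^sub>L f' x)" for x
  have "((\<lambda>x. h (f x) (g x)) has_derivative blinfun_apply (D x)) (at x)" if "x \<in> U" for x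
    using FDERIV[OF f'(1)[OF that] g'(1)[OF that]]
    by (rule has_derivative_eq_rhs)
      (simp add: D_def fun_eq_iff blinfun.add_left prod_left.rep_eq prod_right.rep_eq)
  moreover have "continuous_on U D"
    unfolding D_def
    by (intro continuous_intros f'(2) g'(2) C1_on_imp_continuous_on[OF f] C1_on_imp_continuous_on[OF g]
        bounded_linear.continuous_on[OF bounded_linear_prod_right]
        bounded_linear.continuous_on[OF bounded_linear_prod_left])
  ultimately show ?thesis
    unfolding C1_on_def by blast
qed

lemmas C1_on_mult = C1_on_bilinear[OF bounded_bilinear_mult]

lemma C1_on_add:
  assumes f: "C1_on f U" and g: "C1_on g U"
  shows "C1_on (\<lambda>x. f x + g x) U"
proof -
  obtain f' where f': "\<And>x. x \<in> U \<Longrightarrow> (f has_derivative blinfun_apply (f' x)) (at x)" "continuous_on U f'"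
    using f unfolding C1_on_def by blast
  obtain g' where g': "\<And>x. x \<in> U \<Longrightarrow> (g has_derivative blinfun_apply (g' x)) (at x)" "continuous_on U g'"
    using g unfolding C1_on_def by blast
  show ?thesis
    unfolding C1_on_def
    using f' g'
    by (intro exI[of _ "\<lambda>x. f' x + g' x"]) (auto simp: plus_blinfun.rep_eq intro!: continuous_intros derivative_intros)
qed

lemma C1_on_sum: "(\<And>i. i \<in> I \<Longrightarrow> C1_on (f i) U) \<Longrightarrow> C1_on (\<lambda>x. \<Sum>i\<in>I. f i x) U"
  by (induction I rule: infinite_finite_induct) (auto intro: C1_on_add C1_on_const)

lemma C1_on_prod:
  fixes f :: "'i \<Rightarrow> 'a::real_normed_vector \<Rightarrow> real"
  shows "(\<And>i. i \<in> I \<Longrightarrow> C1_on (f i) U) \<Longrightarrow> C1_on (\<lambda>x. \<Prod>i\<in>I. f i x) U"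
  by (induction I rule: infinite_finite_induct) (auto intro: C1_on_mult C1_on_const)

lemma C1_on_real:
  fixes f :: "real \<Rightarrow> real"
  assumes "\<And>x. x \<in> U \<Longrightarrow> (f has_real_derivative f' x) (at x)" and "continuous_on U f'"
  shows "C1_on f U"
  unfolding C1_on_def
proof (intro exI conjI ballI)
  show "(f has_derivative blinfun_apply (blinfun_scaleR_right (f' x))) (at x)" if "x \<in> U" for x
    using assms(1)[OF that] unfolding has_field_derivative_def
    by (rule has_derivative_eq_rhs) (simp add: fun_eq_iff)
  show "continuous_on U (\<lambda>x. blinfun_scaleR_right (f' x))"
    by (intro bounded_linear.continuous_on[OF bounded_linear_blinfun_scaleR_right] assms(2))
qed

lemma C1_on_sqrt:
  assumes "C1_on f U" "\<And>x. x \<in> U \<Longrightarrow> f x > 0"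
  shows "C1_on (\<lambda>x. sqrt (f x)) U"
proof (rule C1_on_compose[OF assms(1)])
  show "C1_on sqrt {0<..}"
    by (rule C1_on_real[where f' = "\<lambda>x. inverse (sqrt x) / 2"])
       (auto intro!: DERIV_real_sqrt continuous_intros)
qed (use assms(2) in auto)

lemma C1_on_inverse:
  fixes f :: "'a::real_normed_vector \<Rightarrow> real"
  assumes "C1_on f U" "\<And>x. x \<in> U \<Longrightarrow> f x \<noteq> 0"
  shows "C1_on (\<lambda>x. inverse (f x)) U"
proof (rule C1_on_compose[OF assms(1)])
  show "C1_on inverse (- {0::real})"
    by (rule C1_on_real[where f' = "\<lambda>x. - (inverse x ^ Suc (Suc 0))"])
       (auto intro!: DERIV_inverse[THEN DERIV_cong] continuous_intros)
qed (use assms(2) in auto)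

lemma C1_on_matrix_det:
  fixes A :: "'a::real_normed_vector \<Rightarrow> real ^ 'n ^ 'n"
  assumes "\<And>i j. C1_on (\<lambda>x. A x $ i $ j) U"
  shows "C1_on (\<lambda>x. det (A x)) U"
  unfolding det_def by (intro C1_on_sum C1_on_mult C1_on_prod C1_on_const assms)

text \<open>From \<open>G x \<circ> T x = id\<close> one gets \<open>G x - G a = - G x \<circ> (T x - T a) \<circ> G a\<close>, which gives first
  local boundedness, then continuity, then differentiability of \<open>G\<close>.\<close>

lemma blinfun_inverse_diff:
  fixes S T :: "'b::real_normed_vector \<Rightarrow>\<^sub>L 'b"
  assumes "G o\<^sub>L T = id_blinfun" "S o\<^sub>L H = id_blinfun"
  shows "G - H = - (G o\<^sub>L ((T - S) o\<^sub>L H))"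
proof -
  have "G o\<^sub>L ((T - S) o\<^sub>L H) = ((G o\<^sub>L T) o\<^sub>L H) - (G o\<^sub>L (S o\<^sub>L H))"
    by (rule blinfun_eqI) (simp add: blinfun.diff_left blinfun.diff_right)
  also have "\<dots> = H - G"
    unfolding assms by (rule blinfun_eqI) (simp add: blinfun.diff_left)
  finally show ?thesis by simp
qed

lemma continuous_on_blinfun_inverse:
  fixes T :: "'a::real_normed_vector \<Rightarrow> ('b::real_normed_vector \<Rightarrow>\<^sub>L 'b)"
  assumes T: "continuous_on U T" and "open U"
    and inv1: "\<And>x. x \<in> U \<Longrightarrow> G x o\<^sub>L T x = id_blinfun"
    and inv2: "\<And>x. x \<in> U \<Longrightarrow> T x o\<^sub>L G x = id_blinfun"
  shows "continuous_on U G"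
proof -
  have diff: "G x - G a = - (G x o\<^sub>L ((T x - T a) o\<^sub>L G a))" if "x \<in> U" "a \<in> U" for x a
    by (intro blinfun_inverse_diff inv1 inv2 that)
  have nbound: "norm (G x - G a) \<le> norm (G x) * (norm (T x - T a) * norm (G a))" if "x \<in> U" "a \<in> U" for x a
    unfolding diff[OF that] norm_minus_cancel
    by (intro order_trans[OF norm_blinfun_compose] mult_left_mono norm_blinfun_compose norm_ge_zero)
  have evU: "eventually (\<lambda>x. x \<in> U) (at a)" if "a \<in> U" for a
    using \<open>open U\<close> that eventually_at_in_open' by blast
  have contT: "(T \<longlongrightarrow> T a) (at a)" if "a \<in> U" for a
    using T \<open>open U\<close> that by (simp add: continuous_on_eq_continuous_at isCont_def)
  \<comment> \<open>Near \<open>a\<close> the factor multiplying \<open>norm (G x)\<close> in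
    \<open>nbound\<close> is below 1/2, so that term can be absorbed into the left-hand side; this
    produces the 2.\<close>
  have bnd: "eventually (\<lambda>x. norm (G x) \<le> 2 * norm (G a)) (at a)" if a: "a \<in> U" for a
  proof -
    have "((\<lambda>x. norm (T x - T a) * norm (G a)) \<longlongrightarrow> norm (T a - T a) * norm (G a)) (at a)"
      by (intro tendsto_intros contT a)
    then have "eventually (\<lambda>x. norm (T x - T a) * norm (G a) < 1/2) (at a)"
      by (rule order_tendstoD) simp
    with evU[OF a] show ?thesis
    proof eventually_elim
      case (elim x)
      have "norm (G x) \<le> norm (G a) + norm (G x - G a)"
        by (metis add.commute diff_add_cancel norm_triangle_ineq)
      also have "norm (G x - G a) \<le> norm (G x) * (norm (T x - T a) * norm (G a))"
        by (rule nbound[OF elim(1) a])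
      also have "\<dots> \<le> norm (G x) * (1/2)"
        using elim(2) by (intro mult_left_mono) auto
      finally show ?case by simp
    qed
  qed
  have contG: "(G \<longlongrightarrow> G a) (at a)" if a: "a \<in> U" for a
  proof -
    have "((\<lambda>x. 2 * norm (G a) * (norm (T x - T a) * norm (G a))) \<longlongrightarrow> 2 * norm (G a) * (norm (T a - T a) * norm (G a))) (at a)"
      by (intro tendsto_intros contT a)
    then have lim0: "((\<lambda>x. 2 * norm (G a) * (norm (T x - T a) * norm (G a))) \<longlongrightarrow> 0) (at a)" by simp
    have "eventually (\<lambda>x. norm (G x - G a) \<le> 2 * norm (G a) * (norm (T x - T a) * norm (G a))) (at a)"
      using evU[OF a] bnd[OF a]
    proof eventually_elim
      case (elim x)
      show ?case
        using nbound[OF elim(1) a] elim(2)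
        by (meson mult_right_mono norm_ge_zero order_trans mult_nonneg_nonneg)
    qed
    then have "((\<lambda>x. G x - G a) \<longlongrightarrow> 0) (at a)"
      by (rule Lim_null_comparison[OF _ lim0])
    then show ?thesis using LIM_zero_cancel by blast
  qed
  then show ?thesis
    using \<open>open U\<close> by (simp add: continuous_on_eq_continuous_at isCont_def)
qed

lemma C1_on_blinfun_inverse:
  fixes T :: "'a::real_normed_vector \<Rightarrow> ('b::real_normed_vector \<Rightarrow>\<^sub>L 'b)"
  assumes T: "C1_on T U" and "open U"
    and inv1: "\<And>x. x \<in> U \<Longrightarrow> G x o\<^sub>L T x = id_blinfun"
    and inv2: "\<And>x. x \<in> U \<Longrightarrow> T x o\<^sub>L G x = id_blinfun"
  shows "C1_on G U"
proof -
  interpret C: bounded_bilinear "(o\<^sub>L) :: ('b \<Rightarrow>\<^sub>L 'b) \<Rightarrow> ('b \<Rightarrow>\<^sub>L 'b) \<Rightarrow> _"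
    by (rule bounded_bilinear_blinfun_compose)
  obtain T' where T': "\<And>x. x \<in> U \<Longrightarrow> (T has_derivative blinfun_apply (T' x)) (at x)" "continuous_on U T'"
    using T unfolding C1_on_def by blast
  have diff: "G x - G a = - (G x o\<^sub>L ((T x - T a) o\<^sub>L G a))" if "x \<in> U" "a \<in> U" for x a
    by (intro blinfun_inverse_diff inv1 inv2 that)
  have evU: "eventually (\<lambda>x. x \<in> U) (at a)" if "a \<in> U" for a
    using \<open>open U\<close> that eventually_at_in_open' by blast
  have contG_on: "continuous_on U G"
    by (rule continuous_on_blinfun_inverse[OF C1_on_imp_continuous_on[OF T] \<open>open U\<close> inv1 inv2])
  then have contG: "(G \<longlongrightarrow> G a) (at a)" if "a \<in> U" for a
    using \<open>open U\<close> that by (simp add: continuous_on_eq_continuous_at isCont_def)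
  \<comment> \<open>The derivative of inversion, h |-> - G(a) T'(a)h G(a). Writing it with
    \<open>prod_left\<close> and \<open>prod_right\<close> makes its continuity in \<open>a\<close>
    immediate.\<close>
  define G' where "G' a = - (C.prod_right (G a) o\<^sub>L (C.prod_left (G a) o\<^sub>L T' a))" for a
  have G'_apply: "G' a h = - (G a o\<^sub>L (T' a h o\<^sub>L G a))" for a h
    by (simp add: G'_def blinfun.minus_left C.prod_left.rep_eq C.prod_right.rep_eq)
  have der: "(G has_derivative blinfun_apply (G' a)) (at a)" if a: "a \<in> U" for a
    unfolding has_derivative_iff_norm
  proof (intro conjI blinfun.bounded_linear_right)
    define R where "R x = norm (T x - T a - T' a (x - a)) / norm (x - a)" for x
    have R: "(R \<longlongrightarrow> 0) (at a)"
      using T'(1)[OF a] unfolding has_derivative_iff_norm R_def by blast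
    define B where "B x = norm (G x - G a) * (R x + norm (T' a)) * norm (G a) + norm (G a) * (R x * norm (G a))" for x
    have "((\<lambda>x. B x) \<longlongrightarrow> norm (G a - G a) * (0 + norm (T' a)) * norm (G a) + norm (G a) * (0 * norm (G a))) (at a)"
      unfolding B_def by (intro tendsto_intros contG a R)
    then have B0: "(B \<longlongrightarrow> 0) (at a)" by simp
    have "norm (norm (G x - G a - G' a (x - a)) / norm (x - a)) \<le> B x" if x: "x \<in> U" "x \<noteq> a" for x
    proof -
      define E where "E = T x - T a - T' a (x - a)"
      have pos: "norm (x - a) > 0" using x by simp
      \<comment> \<open>Two errors are separated: replacing the outer \<open>G x\<close> by
        \<open>G a\<close>, and replacing \<open>T x - T a\<close> by its linear part. They are the
        two summands of \<open>B\<close>.\<close>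
      have eq: "G x - G a - G' a (x - a) = - ((G x - G a) o\<^sub>L ((T x - T a) o\<^sub>L G a)) - (G a o\<^sub>L (E o\<^sub>L G a))"
        unfolding G'_apply E_def
        by (subst diff[OF x(1) a])
           (rule blinfun_eqI, simp add: blinfun.diff_left blinfun.minus_left blinfun.diff_right)
      have E: "norm E = R x * norm (x - a)"
        using pos by (simp add: R_def E_def)
      have "norm (T x - T a) \<le> norm E + norm (T' a (x - a))"
        unfolding E_def by (metis add.commute diff_add_cancel norm_triangle_ineq)
      also have "\<dots> \<le> R x * norm (x - a) + norm (T' a) * norm (x - a)"
        unfolding E by (intro add_left_mono norm_blinfun)
      finally have dT: "norm (T x - T a) \<le> (R x + norm (T' a)) * norm (x - a)"
        by (simp add: algebra_simps)
      have "norm (G x - G a - G' a (x - a)) \<le>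
          norm (G x - G a) * (norm (T x - T a) * norm (G a)) + norm (G a) * (norm E * norm (G a))"
        unfolding eq
        by (intro order_trans[OF norm_triangle_ineq4] add_mono, unfold norm_minus_cancel;
            intro order_trans[OF norm_blinfun_compose] mult_left_mono norm_blinfun_compose norm_ge_zero)
      also have "\<dots> \<le> norm (G x - G a) * (((R x + norm (T' a)) * norm (x - a)) * norm (G a))
          + norm (G a) * (norm E * norm (G a))"
        by (intro add_right_mono mult_left_mono mult_right_mono dT norm_ge_zero)
      also have "\<dots> = B x * norm (x - a)"
        unfolding E B_def by (simp add: algebra_simps)
      finally show ?thesis
        using pos by (simp add: pos_divide_le_eq)
    qed
    then have "eventually (\<lambda>x. norm (norm (G x - G a - G' a (x - a)) / norm (x - a)) \<le> B x) (at a)"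
      using evU[OF a] eventually_at_filter by (auto simp: eventually_at_filter elim!: eventually_mono)
    then show "((\<lambda>x. norm (G x - G a - G' a (x - a)) / norm (x - a)) \<longlongrightarrow> 0) (at a)"
      by (rule Lim_null_comparison[OF _ B0])
  qed
  have "continuous_on U G'"
    unfolding G'_def
    by (intro continuous_intros T'(2) contG_on
        bounded_linear.continuous_on[OF C.bounded_linear_prod_right]
        bounded_linear.continuous_on[OF C.bounded_linear_prod_left])
  with der show ?thesis unfolding C1_on_def by blast
qed

section \<open>Twice continuously differentiable maps and their local inverses\<close>

lemma C2_on_imp_C1_on: "C2_on f U \<Longrightarrow> C1_on f U"
  unfolding C2_on_def C1_on_def[of f] by (metis C1_on_imp_continuous_on)

lemma C2_on_subset: "C2_on f U \<Longrightarrow> V \<subseteq> U \<Longrightarrow> C2_on f V"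
  unfolding C2_on_def by (meson C1_on_subset subsetD)

lemma C2_on_compose:
  assumes f: "C2_on f U" and g: "C2_on g V" and sub: "f ` U \<subseteq> V"
  shows "C2_on (\<lambda>x. g (f x)) U"
proof -
  obtain f' where f': "\<And>x. x \<in> U \<Longrightarrow> (f has_derivative blinfun_apply (f' x)) (at x)" "C1_on f' U"
    using f unfolding C2_on_def by blast
  obtain g' where g': "\<And>x. x \<in> V \<Longrightarrow> (g has_derivative blinfun_apply (g' x)) (at x)" "C1_on g' V"
    using g unfolding C2_on_def by blast
  have "((\<lambda>x. g (f x)) has_derivative blinfun_apply (g' (f x) o\<^sub>L f' x)) (at x)" if "x \<in> U" for x
    using diff_chain_at[OF f'(1)[OF that] g'(1)[of "f x"]] sub that
    by (auto simp: o_def blinfun_compose.rep_eq)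
  moreover have "C1_on (\<lambda>x. g' (f x) o\<^sub>L f' x) U"
    by (intro C1_on_bilinear[OF bounded_bilinear_blinfun_compose] f'(2)
        C1_on_compose[OF C2_on_imp_C1_on[OF f] g'(2) sub])
  ultimately show ?thesis
    unfolding C2_on_def by (intro exI[of _ "\<lambda>x. g' (f x) o\<^sub>L f' x"]) auto
qed

lemma C2_on_linear_compose:
  assumes "bounded_linear h" "C2_on f U"
  shows "C2_on (\<lambda>x. h (f x)) U"
proof -
  have "C2_on h UNIV"
    unfolding C2_on_def
    by (rule exI[of _ "\<lambda>x. Blinfun h"])
       (auto simp: assms(1) bounded_linear_Blinfun_apply intro: bounded_linear_imp_has_derivative C1_on_const)
  then show ?thesis by (rule C2_on_compose[OF assms(2)]) simp
qed

text \<open>Regularity of the inverse is bootstrapped from the formula g'(y) = f'(g(y))^(-1).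
  Continuity of \<open>g\<close> makes the right-hand side continuous, so \<open>g\<close> is C1;
  then f' o g is C1, and since inversion preserves C1, so is g'.\<close>

lemma C2_local_inverse:
  fixes f :: "'a::euclidean_space \<Rightarrow> 'a"
  assumes f: "C2_on f U" "open U" "x0 \<in> U" and inj: "inj (frechet_derivative f (at x0))"
  obtains U' V g where "open U'" "U' \<subseteq> U" "x0 \<in> U'" "open V" "homeomorphism U' V f g" "C2_on g V"
    "\<And>y. y \<in> V \<Longrightarrow> bij (frechet_derivative g (at y))"
proof -
  obtain f' where f': "\<And>x. x \<in> U \<Longrightarrow> (f has_derivative blinfun_apply (f' x)) (at x)" "C1_on f' U"
    using f unfolding C2_on_def by blast
  have "inj (blinfun_apply (f' x0))"
    using inj frechet_derivative_at[OF f'(1)[OF f(3)]] by simp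
  then obtain h where h: "linear h" "h \<circ> blinfun_apply (f' x0) = id"
    using linear_injective_left_inverse[OF bounded_linear.linear[OF blinfun.bounded_linear_right]] by blast
  have "Blinfun h o\<^sub>L f' x0 = id_blinfun"
    using h by (intro blinfun_eqI) (auto simp: bounded_linear_Blinfun_apply linear_conv_bounded_linear fun_eq_iff)
  from inverse_function_theorem[OF f(2) f'(1) C1_on_imp_continuous_on[OF f'(2)] f(3) this]
  obtain U' V g g' where *: "open U'" "U' \<subseteq> U" "x0 \<in> U'" "open V" "f x0 \<in> V" "homeomorphism U' V f g"
    "\<And>y. y \<in> V \<Longrightarrow> (g has_derivative (g' y)) (at y)"
    "\<And>y. y \<in> V \<Longrightarrow> g' y = inv (blinfun_apply (f'(g y)))"
    "\<And>y. y \<in> V \<Longrightarrow> bij (blinfun_apply (f'(g y)))"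
    by blast
  define G where "G y = Blinfun (g' y)" for y
  have G: "blinfun_apply (G y) = g' y" if "y \<in> V" for y
    unfolding G_def using *(7)[OF that] by (intro bounded_linear_Blinfun_apply has_derivative_bounded_linear)
  have gV: "g ` V \<subseteq> U" using *(2,6) by (auto simp: homeomorphism_def)
  have inv1: "G y o\<^sub>L f' (g y) = id_blinfun" if "y \<in> V" for y
    using *(9)[OF that] by (intro blinfun_eqI) (simp add: G[OF that] *(8)[OF that] bij_is_inj)
  have inv2: "f' (g y) o\<^sub>L G y = id_blinfun" if "y \<in> V" for y
    using *(9)[OF that] by (intro blinfun_eqI) (simp add: G[OF that] *(8)[OF that] bij_is_surj surj_f_inv_f)
  have "continuous_on V g" using *(6) by (auto simp: homeomorphism_def)
  then have "continuous_on V (\<lambda>y. f' (g y))"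
    by (intro continuous_on_compose2[OF C1_on_imp_continuous_on[OF f'(2)]] gV)
  then have "continuous_on V G"
    by (rule continuous_on_blinfun_inverse[OF _ *(4) inv1 inv2])
  then have "C1_on g V"
    unfolding C1_on_def using *(7) by (intro exI[of _ G]) (simp add: G)
  then have "C1_on (\<lambda>y. f' (g y)) V"
    by (rule C1_on_compose[OF _ f'(2) gV])
  then have "C1_on G V"
    by (rule C1_on_blinfun_inverse[OF _ *(4) inv1 inv2])
  then have "C2_on g V"
    unfolding C2_on_def using *(7) by (intro exI[of _ G]) (simp add: G)
  moreover have "bij (frechet_derivative g (at y))" if "y \<in> V" for y
    unfolding frechet_derivative_at[OF *(7)[OF that], symmetric] *(8)[OF that]
    by (intro bij_imp_bij_inv *(9) that)
  ultimately show thesis using * by (intro that[of U' V g])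
qed

subsection \<open>Convex graph charts\<close>

text \<open>Orthogonal projection onto the hyperplane normal to \<open>e\<close>, followed by an
  isometry of that hyperplane with \<open>real ^ 'n\<close>, which exists by equality of
  dimensions.\<close>

lemma exists_linear_projection_along:
  fixes e :: "real ^ ('n::finite + 1)"
  assumes "e \<noteq> 0"
  obtains P :: "real ^ ('n + 1) \<Rightarrow> real ^ 'n"
  where "linear P" "\<And>x. P x = 0 \<Longrightarrow> \<exists>k. x = k *\<^sub>R e"
proof -
  define T where "T = {x. e \<bullet> x = 0}"
  have "subspace T" unfolding T_def by (rule subspace_hyperplane)
  moreover have "dim T = dim (UNIV :: (real ^ 'n) set)"
    using assms by (simp add: T_def dim_hyperplane)
  ultimately obtain f :: "real ^ 'n \<Rightarrow> real ^ ('n + 1)" and g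
    where fg: "linear f" "linear g" "g ` T = UNIV" "\<And>x. x \<in> T \<Longrightarrow> f (g x) = x"
    using isometries_subspaces[of T "UNIV :: (real ^ 'n) set"] by (metis subspace_UNIV)
  define P where "P x = g (x - ((e \<bullet> x) / (e \<bullet> e)) *\<^sub>R e)" for x
  show thesis
  proof
    show "linear P"
      unfolding P_def
      by (intro linearI)
         (simp_all add: linear_diff[OF fg(2)] linear_cmul[OF fg(2)] linear_add[OF fg(2)]
           inner_add_right add_divide_distrib algebra_simps)
    show "\<exists>k. x = k *\<^sub>R e" if "P x = 0" for x
    proof -
      define z where "z = x - ((e \<bullet> x) / (e \<bullet> e)) *\<^sub>R e"
      have "z \<in> T" using assms by (simp add: T_def z_def inner_diff_right)
      then have "z = f (g z)" using fg(4) by simp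
      also have "g z = 0" using that by (simp add: P_def z_def)
      finally have "z = 0" using fg(1) by (simp add: linear_0)
      then show ?thesis by (auto simp: z_def)
    qed
  qed
qed

text \<open>The chart is the inverse of a projection along the direction from \<open>p\<close> to an interior point;
  in it every coordinate except one is affine, and convexity of the domain makes the remaining
  one convex.\<close>

lemma convex_graph_chart:
  fixes S :: "(real ^ ('n::finite + 1)) set"
  assumes \<Omega>: "open \<Omega>" "convex \<Omega>" "S = frontier \<Omega>"
    and patch: "C2_patch S U \<phi>" and p: "p \<in> \<phi> ` U"
  obtains \<Phi> y0 R where "R > 0" "C2_patch S (ball y0 R) \<Phi>" "\<Phi> y0 = p"
    "\<And>v. convex_on (ball y0 R) (\<lambda>y. v \<bullet> \<Phi> y) \<or> convex_on (ball y0 R) (\<lambda>y. - v \<bullet> \<Phi> y)"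
proof -
  have U: "open U" "C2_on \<phi> U" "\<And>y. y \<in> U \<Longrightarrow> inj (frechet_derivative \<phi> (at y))"
    "openin (top_of_set S) (\<phi> ` U)"
    using patch unfolding C2_patch_def by auto
  obtain \<rho> where \<rho>: "homeomorphism U (\<phi> ` U) \<phi> \<rho>"
    using patch unfolding C2_patch_def by auto
  have imS: "\<phi> ` U \<subseteq> S" using U(4) openin_imp_subset by blast
  obtain u0 where u0: "u0 \<in> U" "p = \<phi> u0" using p by auto
  have S_cl: "S \<subseteq> closure \<Omega>" and S_disj: "S \<inter> \<Omega> = {}"
    using \<Omega> by (auto simp: frontier_def interior_open)
  have pS: "p \<in> S" using p imS by auto
  then obtain c where "c \<in> \<Omega>" using S_cl by (metis closure_empty empty_iff equals0I subsetD)
  then obtain r where r: "r > 0" "ball c r \<subseteq> \<Omega>" using \<Omega>(1) open_contains_ball by blast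
  define e where "e = c - p"
  have "e \<noteq> 0" using pS \<open>c \<in> \<Omega>\<close> S_disj by (auto simp: e_def)
  have shrink: "x + \<tau> *\<^sub>R (d - x) \<in> \<Omega>" if "x \<in> closure \<Omega>" "d \<in> ball c r" "0 < \<tau>" "\<tau> \<le> 1" for x d \<tau>
    using mem_interior_closure_convex_shrink[OF \<Omega>(2), of d x \<tau>] that r \<Omega>(1)
    by (auto simp: interior_open algebra_simps)
  obtain P :: "real ^ ('n + 1) \<Rightarrow> real ^ 'n"
    where P: "linear P" and kerP: "\<And>x. P x = 0 \<Longrightarrow> \<exists>k. x = k *\<^sub>R e"
    using exists_linear_projection_along[OF \<open>e \<noteq> 0\<close>] by metis
  have blP: "bounded_linear P" using P by (simp add: linear_conv_bounded_linear)
  define q where "q u = P (\<phi> u)" for u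
  have C2q: "C2_on q U"
    unfolding q_def by (rule C2_on_linear_compose[OF blP U(2)])
  have d\<phi>: "(\<phi> has_derivative frechet_derivative \<phi> (at u)) (at u)" if "u \<in> U" for u
    using C1_on_imp_differentiable[OF C2_on_imp_C1_on[OF U(2)] that] frechet_derivative_works by blast
  let ?D = "frechet_derivative \<phi> (at u0)"
  have linD: "linear ?D" using d\<phi>[OF u0(1)] has_derivative_linear by blast
  have dq: "frechet_derivative q (at u0) = (\<lambda>w. P (?D w))"
    unfolding q_def
    by (rule frechet_derivative_at[symmetric])
       (rule bounded_linear.has_derivative[OF blP d\<phi>[OF u0(1)]])
  \<comment> \<open>The direction \<open>e\<close> into the domain is not tangent to
    \<open>S\<close>. Otherwise a curve in \<open>S\<close> leaves \<open>p\<close> with velocity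
    \<open>e\<close>; for small s its secant end point \<open>d\<close> lies in
    \<open>ball c r\<close>, and \<open>shrink\<close> then puts the curve point at time s inside
    \<Omega>, which \<open>S\<close> does not meet.\<close>
  have "inj (\<lambda>w. P (?D w))"
  proof -
    have lin: "linear (\<lambda>w. P (?D w))" using linear_compose[OF linD P] by (simp add: o_def)
    show ?thesis
      unfolding linear_injective_0[OF lin]
    proof (intro allI impI, rule ccontr)
      fix w assume w: "P (?D w) = 0" "w \<noteq> 0"
      obtain k where k: "?D w = k *\<^sub>R e" using kerP w(1) by blast
      have "?D w \<noteq> 0" using U(3)[OF u0(1)] w(2) linear_injective_0[OF linD] by blast
      then have "k \<noteq> 0" using k by auto
      define w' where "w' = w /\<^sub>R k"
      have Dw': "?D w' = e" using k \<open>k \<noteq> 0\<close> by (simp add: w'_def linear_cmul[OF linD])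
      have "((\<lambda>s. \<phi> (u0 + s *\<^sub>R w')) has_derivative (\<lambda>s. ?D (s *\<^sub>R w'))) (at 0)"
        by (rule has_derivative_compose[of "\<lambda>s. u0 + s *\<^sub>R w'" "\<lambda>s. s *\<^sub>R w'" 0 UNIV \<phi> ?D])
           (auto intro!: derivative_eq_intros d\<phi> u0)
      then have "((\<lambda>s. \<phi> (u0 + s *\<^sub>R w')) has_vector_derivative e) (at 0)"
        unfolding has_vector_derivative_def by (simp add: linear_cmul[OF linD] Dw')
      then have "((\<lambda>s. norm (\<phi> (u0 + s *\<^sub>R w') - p - s *\<^sub>R e) / norm s) \<longlongrightarrow> 0) (at 0)"
        by (simp add: has_vector_derivative_def has_derivative_iff_norm u0(2))
      then have lim: "((\<lambda>s. norm (\<phi> (u0 + s *\<^sub>R w') - p - s *\<^sub>R e) / norm s) \<longlongrightarrow> 0) (at_right 0)"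
        by (rule filterlim_mono) (auto simp: at_le)
      have "((\<lambda>s. u0 + s *\<^sub>R w') \<longlongrightarrow> u0 + 0 *\<^sub>R w') (at_right (0::real))"
        by (intro tendsto_intros)
      then have "eventually (\<lambda>s. u0 + s *\<^sub>R w' \<in> U) (at_right (0::real))"
        using U(1) u0(1) topological_tendstoD by fastforce
      moreover have "eventually (\<lambda>s. norm (\<phi> (u0 + s *\<^sub>R w') - p - s *\<^sub>R e) / norm s < r) (at_right 0)"
        using order_tendstoD(2)[OF lim r(1)] .
      moreover have "eventually (\<lambda>s. 0 < s \<and> s < (1::real)) (at_right 0)"
        by (auto simp: eventually_at_right_field intro: exI[of _ 1])
      ultimately have "eventually (\<lambda>s. u0 + s *\<^sub>R w' \<in> U \<and> norm (\<phi> (u0 + s *\<^sub>R w') - p - s *\<^sub>R e) / norm s < r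
          \<and> 0 < s \<and> s < (1::real)) (at_right 0)"
        by eventually_elim auto
      then obtain s where s: "u0 + s *\<^sub>R w' \<in> U" "norm (\<phi> (u0 + s *\<^sub>R w') - p - s *\<^sub>R e) / norm s < r" "0 < s" "s < 1"
        using eventually_happens'[OF trivial_limit_at_right_real] by blast
      define d where "d = p + (\<phi> (u0 + s *\<^sub>R w') - p) /\<^sub>R s"
      have "d - c = (\<phi> (u0 + s *\<^sub>R w') - p - s *\<^sub>R e) /\<^sub>R s"
        using s(3) by (simp add: d_def e_def scaleR_diff_right)
      then have "norm (d - c) < r" using s(2,3) by (simp add: divide_inverse mult.commute)
      then have "d \<in> ball c r" by (simp add: dist_norm norm_minus_commute)
      then have "p + s *\<^sub>R (d - p) \<in> \<Omega>" using shrink s pS S_cl by auto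
      moreover have "p + s *\<^sub>R (d - p) = \<phi> (u0 + s *\<^sub>R w')" using s(3) by (simp add: d_def)
      ultimately show False using s(1) imS S_disj by auto
    qed
  qed
  then have "inj (frechet_derivative q (at u0))" using dq by simp
  then obtain U1 V1 g where 1: "open U1" "U1 \<subseteq> U" "u0 \<in> U1" "open V1" "homeomorphism U1 V1 q g" "C2_on g V1"
    "\<And>y. y \<in> V1 \<Longrightarrow> bij (frechet_derivative g (at y))"
    using C2_local_inverse[OF C2q U(1) u0(1)] by blast
  define y0 where "y0 = q u0"
  define \<Phi> where "\<Phi> y = \<phi> (g y)" for y
  have "y0 \<in> V1" using 1(3,5) by (auto simp: y0_def homeomorphism_def)
  have gV1: "g ` V1 = U1" using 1(5) by (simp add: homeomorphism_def)
  have "g y0 = u0" using 1(3,5) by (auto simp: y0_def homeomorphism_def)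
  then have \<Phi>y0: "\<Phi> y0 = p" by (simp add: \<Phi>_def u0)
  have P\<Phi>: "P (\<Phi> y) = y" if "y \<in> V1" for y
    using 1(5) that by (auto simp: \<Phi>_def homeomorphism_def simp flip: q_def)
  have C2\<Phi>: "C2_on \<Phi> V1"
    unfolding \<Phi>_def by (rule C2_on_compose[OF 1(6) U(2)]) (use gV1 1(2) in auto)
  \<comment> \<open>The bound \<open>r\<close> keeps \<open>z + e\<close> in \<open>ball c r\<close>
    for \<open>z\<close> in \<open>ball p m\<close>; the bound \<open>norm e / 2\<close> keeps two
    points of \<open>ball p m\<close> closer than \<open>norm e\<close>, which forces k < 1 below.
    Both are needed to apply \<open>shrink\<close>.\<close>
  define m where "m = min r (norm e / 2)"
  have "m > 0" using r(1) \<open>e \<noteq> 0\<close> by (simp add: m_def)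
  have "isCont \<Phi> y0"
    using C1_on_imp_differentiable[OF C2_on_imp_C1_on[OF C2\<Phi>] \<open>y0 \<in> V1\<close>] by (rule differentiable_imp_continuous_within)
  then obtain R1 where R1: "R1 > 0" "\<And>y. dist y y0 < R1 \<Longrightarrow> dist (\<Phi> y) p < m"
    using \<open>m > 0\<close> \<Phi>y0 unfolding continuous_at_eps_delta by metis
  obtain R2 where R2: "R2 > 0" "ball y0 R2 \<subseteq> V1" using \<open>open V1\<close> \<open>y0 \<in> V1\<close> open_contains_ball by blast
  define R where "R = min R1 R2"
  have R: "R > 0" "ball y0 R \<subseteq> V1" "\<And>y. y \<in> ball y0 R \<Longrightarrow> \<Phi> y \<in> ball p m"
    using R1 R2 by (auto simp: R_def dist_commute)
  let ?V = "ball y0 R"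
  have \<Phi>S: "\<Phi> y \<in> S" if "y \<in> ?V" for y
  proof -
    have "g y \<in> U" using that R(2) gV1 1(2) by blast
    then show ?thesis using imS by (auto simp: \<Phi>_def)
  qed
  have "C2_patch S ?V \<Phi>"
    unfolding C2_patch_def
  proof (intro conjI ballI)
    show "C2_on \<Phi> ?V" using C2_on_subset C2\<Phi> R(2) by blast
    show "inj (frechet_derivative \<Phi> (at y))" if "y \<in> ?V" for y
    proof -
      have y: "y \<in> V1" using that R(2) by blast
      have gy: "g y \<in> U" using y gV1 1(2) by blast
      have "(g has_derivative frechet_derivative g (at y)) (at y)"
        using C1_on_imp_differentiable[OF C2_on_imp_C1_on[OF 1(6)] y] frechet_derivative_works by blast
      from diff_chain_at[OF this d\<phi>[OF gy]]
      have "(\<Phi> has_derivative frechet_derivative \<phi> (at (g y)) \<circ> frechet_derivative g (at y)) (at y)"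
        unfolding \<Phi>_def o_def .
      then have "frechet_derivative \<Phi> (at y) = frechet_derivative \<phi> (at (g y)) \<circ> frechet_derivative g (at y)"
        by (rule frechet_derivative_at[symmetric])
      then show ?thesis using U(3)[OF gy] 1(7)[OF y] by (simp add: inj_compose bij_is_inj)
    qed
    show "openin (top_of_set S) (\<Phi> ` ?V)"
    proof -
      have "openin (top_of_set U1) (g ` ?V)"
        using homeomorphism_imp_open_map[OF homeomorphism_symD[OF 1(5)]] R(2) by (simp add: open_subset)
      then have "open (g ` ?V)" using 1(1) openin_open_trans by blast
      moreover have "g ` ?V \<subseteq> U" using gV1 R(2) 1(2) by blast
      ultimately have "openin (top_of_set U) (g ` ?V)" by (simp add: open_subset)
      then have "openin (top_of_set (\<phi> ` U)) (\<phi> ` g ` ?V)"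
        by (rule homeomorphism_imp_open_map[OF \<rho>])
      then show ?thesis unfolding \<Phi>_def using U(4) openin_trans by (metis (no_types, lifting) image_image image_cong)
    qed
    have "continuous_on ?V \<Phi>" using C1_on_imp_continuous_on[OF C2_on_imp_C1_on[OF C2\<Phi>]] R(2) continuous_on_subset by blast
    then have "homeomorphism ?V (\<Phi> ` ?V) \<Phi> P"
      using R(2) P\<Phi> by (intro homeomorphismI linear_continuous_on[OF blP]) auto
    then show "\<exists>\<rho>. homeomorphism ?V (\<Phi> ` ?V) \<Phi> \<rho>" by blast
  qed auto
  \<comment> \<open>A chord of the graph lies in the closure of the domain, and the surface point
    over the same base point differs from it by a multiple of \<open>e\<close>. Moving inward by k >
    0 would reach the open domain, so the surface lies on the outer side.\<close>
  moreover have **: "\<exists>k\<le>0. \<Phi> ((1 - t) *\<^sub>R x + t *\<^sub>R y) = (1 - t) *\<^sub>R \<Phi> x + t *\<^sub>R \<Phi> y + k *\<^sub>R e"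
    if "x \<in> ?V" "y \<in> ?V" "0 < t" "t < 1" for x y t
  proof -
    define u where "u = (1 - t) *\<^sub>R x + t *\<^sub>R y"
    define z where "z = (1 - t) *\<^sub>R \<Phi> x + t *\<^sub>R \<Phi> y"
    have u: "u \<in> ?V" unfolding u_def using that by (intro convexD[OF convex_ball]) auto
    have zb: "z \<in> ball p m" unfolding z_def using that R(3) by (intro convexD[OF convex_ball]) auto
    have zc: "z \<in> closure \<Omega>" unfolding z_def using that \<Phi>S S_cl
      by (intro convexD[OF convex_closure[OF \<Omega>(2)]]) auto
    have "P z = (1 - t) *\<^sub>R x + t *\<^sub>R y"
      unfolding z_def using that R(2) P\<Phi> by (auto simp: linear_add[OF P] linear_cmul[OF P] subset_iff)
    also have "\<dots> = P (\<Phi> u)" using P\<Phi>[of u] u R(2) u_def by auto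
    finally have "P (\<Phi> u - z) = 0" by (simp add: linear_diff[OF P])
    then obtain k where k: "\<Phi> u - z = k *\<^sub>R e" using kerP by blast
    have "k \<le> 0"
    proof (rule ccontr)
      assume "\<not> k \<le> 0"
      have "norm (\<Phi> u - z) < m + m"
        using R(3)[OF u] zb dist_triangle_less_add[of "\<Phi> u" p m z m] by (simp add: dist_norm norm_minus_commute)
      also have "\<dots> \<le> norm e" by (simp add: m_def)
      finally have "k * norm e < 1 * norm e" using k \<open>\<not> k \<le> 0\<close> by simp
      then have "k < 1" using \<open>e \<noteq> 0\<close> by (simp only: mult_less_cancel_right) auto
      have "z + e \<in> ball c r"
        using zb by (simp add: e_def m_def dist_norm algebra_simps)
      then have "z + k *\<^sub>R e \<in> \<Omega>"
        using shrink[OF zc, of "z + e" k] \<open>\<not> k \<le> 0\<close> \<open>k < 1\<close> by simp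
      moreover have "z + k *\<^sub>R e = \<Phi> u" using k by (simp add: algebra_simps)
      ultimately show False using \<Phi>S[OF u] S_disj by auto
    qed
    then show ?thesis using k by (auto simp: u_def z_def algebra_simps intro!: exI[of _ k])
  qed
  \<comment> \<open>The only departure from affinity is the term k e with k \<le> 0, so the sign of
    v . e decides which of v and -v gives a convex function.\<close>
  moreover have "convex_on ?V (\<lambda>y. v \<bullet> \<Phi> y) \<or> convex_on ?V (\<lambda>y. - v \<bullet> \<Phi> y)" for v
  proof (cases "v \<bullet> e \<ge> 0")
    case True
    have "convex_on ?V (\<lambda>y. v \<bullet> \<Phi> y)"
    proof (rule convex_onI)
      fix t x y assume *: "(0::real) < t" "t < 1" "x \<in> ?V" "y \<in> ?V"
      obtain k where "k \<le> 0" "\<Phi> ((1 - t) *\<^sub>R x + t *\<^sub>R y) = (1 - t) *\<^sub>R \<Phi> x + t *\<^sub>R \<Phi> y + k *\<^sub>R e"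
        using ** [of x y t] * by blast
      then show "v \<bullet> \<Phi> ((1 - t) *\<^sub>R x + t *\<^sub>R y) \<le> (1 - t) * (v \<bullet> \<Phi> x) + t * (v \<bullet> \<Phi> y)"
        using True by (simp add: inner_add_right mult_nonpos_nonneg)
    qed auto
    then show ?thesis ..
  next
    case False
    have "convex_on ?V (\<lambda>y. - v \<bullet> \<Phi> y)"
    proof (rule convex_onI)
      fix t x y assume *: "(0::real) < t" "t < 1" "x \<in> ?V" "y \<in> ?V"
      obtain k where "k \<le> 0" "\<Phi> ((1 - t) *\<^sub>R x + t *\<^sub>R y) = (1 - t) *\<^sub>R \<Phi> x + t *\<^sub>R \<Phi> y + k *\<^sub>R e"
        using ** [of x y t] * by blast
      then show "- v \<bullet> \<Phi> ((1 - t) *\<^sub>R x + t *\<^sub>R y) \<le> (1 - t) * (- v \<bullet> \<Phi> x) + t * (- v \<bullet> \<Phi> y)"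
        using False by (simp add: inner_add_right mult_nonpos_nonpos)
    qed auto
    then show ?thesis ..
  qed
  ultimately show thesis using R(1) \<Phi>y0 by (intro that[of R y0 \<Phi>])
qed

subsection \<open>Surface measure in a chart\<close>

text \<open>The determinant is positive at the identity and, by definiteness, does not vanish along the
  segment from the identity to the Gram matrix.\<close>

lemma det_gram_pos:
  fixes J :: "real ^ 'n ^ 'm"
  assumes "inj ((*v) J)"
  shows "det (transpose J ** J) > 0"
proof (rule ccontr)
  assume neg: "\<not> det (transpose J ** J) > 0"
  define M where "M t = (1 - t) *\<^sub>R (mat 1 :: real ^ 'n ^ 'n) + t *\<^sub>R (transpose J ** J)" for t :: real
  have "\<exists>t\<ge>0. t \<le> 1 \<and> det (M t) = 0"
  proof (rule IVT2')
    show "continuous_on {0..1} (\<lambda>t. det (M t))"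
      unfolding det_def M_def by (intro continuous_intros)
  qed (use neg in \<open>auto simp: M_def\<close>)
  then obtain t where t: "0 \<le> t" "t \<le> 1" "det (M t) = 0" by blast
  then have "\<not> invertible (M t)" by (simp add: invertible_det_nz)
  then obtain x where x: "M t *v x = 0" "x \<noteq> 0"
    using invertible_left_inverse matrix_left_invertible_ker by blast
  have "M t *v x = (1 - t) *\<^sub>R x + t *\<^sub>R (transpose J *v (J *v x))"
    by (simp add: M_def matrix_vector_mult_add_rdistrib scaleR_matrix_vector_assoc[symmetric]
        matrix_vector_mul_assoc)
  then have "0 = x \<bullet> ((1 - t) *\<^sub>R x + t *\<^sub>R (transpose J *v (J *v x)))" using x by simp
  also have "\<dots> = (1 - t) * (x \<bullet> x) + t * ((J *v x) \<bullet> (J *v x))"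
    by (simp add: inner_add_right dot_lmul_matrix[symmetric] inner_commute)
  finally have eq: "(1 - t) * (x \<bullet> x) + t * ((J *v x) \<bullet> (J *v x)) = 0" by simp
  have "J *v x \<noteq> 0" using assms x(2) by (metis injD matrix_vector_mult_0_right)
  then have pos: "(J *v x) \<bullet> (J *v x) > 0" "x \<bullet> x > 0" using x(2) by auto
  have "(1 - t) * (x \<bullet> x) \<ge> 0" "t * ((J *v x) \<bullet> (J *v x)) \<ge> 0" using t by auto
  then have "(1 - t) * (x \<bullet> x) = 0" "t * ((J *v x) \<bullet> (J *v x)) = 0"
    using eq by linarith+
  then show False using pos by simp
qed

lemma area_element_pos:
  assumes "C2_patch S V \<Phi>" "y \<in> V"
  shows "area_element \<Phi> y > 0"
proof -
  let ?D = "frechet_derivative \<Phi> (at y)"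
  have "\<Phi> differentiable (at y)"
    using assms C1_on_imp_differentiable[OF C2_on_imp_C1_on] by (auto simp: C2_patch_def)
  then have "linear ?D" using frechet_derivative_works has_derivative_linear by blast
  then have "(*v) (matrix ?D) = ?D" by (auto simp: matrix_works)
  moreover have "inj ?D" using assms by (auto simp: C2_patch_def)
  ultimately show ?thesis
    unfolding area_element_def Let_def using det_gram_pos[of "matrix ?D"] by simp
qed

text \<open>The Gram determinant is a polynomial in first derivatives of the chart and is positive,
  so the square root is applied away from 0. One derivative of the area element is required because
  it becomes part of the amplitude in the integration by parts.\<close>

lemma C1_on_area_element:
  assumes patch: "C2_patch S V \<Phi>"
  shows "C1_on (area_element \<Phi>) V"
proof -
  have V: "open V" "C2_on \<Phi> V" using patch by (auto simp: C2_patch_def)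
  obtain f' where f': "\<And>x. x \<in> V \<Longrightarrow> (\<Phi> has_derivative blinfun_apply (f' x)) (at x)" "C1_on f' V"
    using V(2) unfolding C2_on_def by blast
  have fd: "frechet_derivative \<Phi> (at y) = blinfun_apply (f' y)" if "y \<in> V" for y
    using frechet_derivative_at[OF f'(1)[OF that]] by simp
  have entry: "C1_on (\<lambda>y. matrix (blinfun_apply (f' y)) $ k $ i) V" for k i
  proof -
    have "C1_on (\<lambda>y. blinfun_apply (f' y) (axis i 1)) V"
      by (rule C1_on_linear_compose[OF blinfun.bounded_linear_left f'(2)])
    then have "C1_on (\<lambda>y. blinfun_apply (f' y) (axis i 1) $ k) V"
      by (rule C1_on_linear_compose[OF bounded_linear_vec_nth])
    then show ?thesis by (simp add: matrix_def)
  qed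
  have "C1_on (\<lambda>y. det (transpose (matrix (blinfun_apply (f' y))) ** matrix (blinfun_apply (f' y)))) V"
    by (intro C1_on_matrix_det)
       (simp add: matrix_matrix_mult_def transpose_def, intro C1_on_sum C1_on_mult entry)
  moreover have "det (transpose (matrix (blinfun_apply (f' y))) ** matrix (blinfun_apply (f' y))) > 0" if "y \<in> V" for y
    using area_element_pos[OF patch that] by (simp add: area_element_def Let_def fd[OF that])
  ultimately have "C1_on (\<lambda>y. sqrt (det (transpose (matrix (blinfun_apply (f' y))) ** matrix (blinfun_apply (f' y))))) V"
    by (rule C1_on_sqrt)
  then show ?thesis
    by (rule C1_on_cong[OF _ V(1)]) (simp add: area_element_def Let_def fd)
qed

lemma surface_measure_on_sets: "surface_measure_on S \<nu> \<Longrightarrow> sets \<nu> = sets borel"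
  by (simp add: surface_measure_on_def)

lemma surface_measure_on_patch:
  assumes "surface_measure_on S \<nu>" "C2_patch S V \<Phi>" "A \<in> sets borel" "A \<subseteq> \<Phi> ` V"
  shows "emeasure \<nu> A = (\<integral>\<^sup>+y\<in>V. (ennreal (area_element \<Phi> y) * indicator A (\<Phi> y)) \<partial>lborel)"
  using assms unfolding surface_measure_on_def by blast

lemma C2_patch_image_borel:
  assumes "closed S" "C2_patch S V \<Phi>"
  shows "\<Phi> ` V \<in> sets borel" "\<Phi> ` V \<subseteq> S"
proof -
  have o: "openin (top_of_set S) (\<Phi> ` V)" using assms(2) by (simp add: C2_patch_def)
  then obtain T where "open T" "\<Phi> ` V = S \<inter> T" by (auto simp: openin_open)
  then show "\<Phi> ` V \<in> sets borel" using assms(1) by simp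
  show "\<Phi> ` V \<subseteq> S" using o openin_imp_subset by blast
qed

lemma C2_patch_continuous_on: "C2_patch S V \<Phi> \<Longrightarrow> continuous_on V \<Phi>"
  by (simp add: C2_patch_def C1_on_imp_continuous_on C2_on_imp_C1_on)

text \<open>The definition prescribes only measures of Borel sets. The restriction of \<nu> to the
  patch is therefore identified with the push-forward of weighted Lebesgue measure, and integrals
  follow by change of variables.\<close>

lemma surface_integral_patch:
  fixes h :: "real ^ ('n::finite + 1) \<Rightarrow> complex"
  assumes S: "closed S" and \<nu>: "surface_measure_on S \<nu>" and patch: "C2_patch S V \<Phi>"
    and h: "h \<in> borel_measurable borel" and h0: "\<And>x. x \<notin> \<Phi> ` V \<Longrightarrow> h x = 0"
  shows "integral\<^sup>L \<nu> h = (\<integral>y. indicator V y *\<^sub>R (area_element \<Phi> y *\<^sub>R h (\<Phi> y)) \<partial>lborel)"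
proof -
  have sets\<nu>: "sets \<nu> = sets borel" using \<nu> by (rule surface_measure_on_sets)
  note [measurable_cong] = sets\<nu>
  have V: "open V" using patch by (simp add: C2_patch_def)
  have im: "\<Phi> ` V \<in> sets borel" using C2_patch_image_borel[OF S patch] by simp
  have Vm [measurable]: "V \<in> sets borel" using V by simp
  note h [measurable] im [measurable]
  define w where "w y = indicator V y * area_element \<Phi> y" for y
  have w_nonneg: "w y \<ge> 0" for y
    using area_element_pos[OF patch, of y] by (auto simp: w_def indicator_def)
  have wm [measurable]: "w \<in> borel_measurable borel"
    using borel_measurable_continuous_on_indicator[OF Vm C1_on_imp_continuous_on[OF C1_on_area_element[OF patch]]]
    by (simp add: w_def[abs_def])
  \<comment> \<open>Setting the chart to 0 off \<open>V\<close> makes it Borel on the whole space;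
    the weight \<open>w\<close> vanishes there, so the value is irrelevant.\<close>
  define F where "F y = indicator V y *\<^sub>R \<Phi> y" for y
  have Fm [measurable]: "F \<in> borel_measurable borel"
    unfolding F_def
    using borel_measurable_continuous_on_indicator[OF Vm C2_patch_continuous_on[OF patch]] by simp
  have eq: "density \<nu> (\<lambda>x. ennreal (indicator (\<Phi> ` V) x)) = distr (density lborel (\<lambda>y. ennreal (w y))) borel F"
  proof (rule measure_eqI)
    show "sets (density \<nu> (\<lambda>x. ennreal (indicator (\<Phi> ` V) x))) = sets (distr (density lborel (\<lambda>y. ennreal (w y))) borel F)"
      by (simp add: sets\<nu>)
    fix A assume "A \<in> sets (density \<nu> (\<lambda>x. ennreal (indicator (\<Phi> ` V) x)))"
    then have A [measurable]: "A \<in> sets borel" by (simp add: sets\<nu>)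
    have "emeasure (density \<nu> (\<lambda>x. ennreal (indicator (\<Phi> ` V) x))) A
        = (\<integral>\<^sup>+x. ennreal (indicator (\<Phi> ` V) x) * indicator A x \<partial>\<nu>)"
      by (rule emeasure_density) (auto simp: sets\<nu> A)
    also have "\<dots> = (\<integral>\<^sup>+x. indicator (\<Phi> ` V \<inter> A) x \<partial>\<nu>)"
      by (intro nn_integral_cong) (auto simp: indicator_def)
    also have "\<dots> = emeasure \<nu> (\<Phi> ` V \<inter> A)"
      by (intro nn_integral_indicator) (simp add: sets\<nu> im A)
    also have "\<dots> = (\<integral>\<^sup>+y\<in>V. (ennreal (area_element \<Phi> y) * indicator (\<Phi> ` V \<inter> A) (\<Phi> y)) \<partial>lborel)"
      by (rule surface_measure_on_patch[OF \<nu> patch]) (auto simp: im A)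
    also have "\<dots> = (\<integral>\<^sup>+y. ennreal (w y) * indicator (F -` A) y \<partial>lborel)"
      by (intro nn_integral_cong) (auto simp: w_def F_def indicator_def)
    also have "\<dots> = emeasure (density lborel (\<lambda>y. ennreal (w y))) (F -` A)"
      by (subst emeasure_density) (use measurable_sets[OF Fm A] in auto)
    also have "\<dots> = emeasure (distr (density lborel (\<lambda>y. ennreal (w y))) borel F) A"
      by (subst emeasure_distr) auto
    finally show "emeasure (density \<nu> (\<lambda>x. ennreal (indicator (\<Phi> ` V) x))) A
        = emeasure (distr (density lborel (\<lambda>y. ennreal (w y))) borel F) A" .
  qed
  have "integral\<^sup>L \<nu> h = (\<integral>x. indicator (\<Phi> ` V) x *\<^sub>R h x \<partial>\<nu>)"
    using h0 by (intro Bochner_Integration.integral_cong) (auto simp: indicator_def)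
  also have "\<dots> = integral\<^sup>L (density \<nu> (\<lambda>x. ennreal (indicator (\<Phi> ` V) x))) h"
    by (subst integral_density) auto
  also have "\<dots> = (\<integral>y. w y *\<^sub>R h (F y) \<partial>lborel)"
    unfolding eq using w_nonneg by (subst integral_distr) (auto simp: integral_density)
  also have "\<dots> = (\<integral>y. indicator V y *\<^sub>R (area_element \<Phi> y *\<^sub>R h (\<Phi> y)) \<partial>lborel)"
    by (intro Bochner_Integration.integral_cong) (auto simp: w_def F_def indicator_def)
  finally show ?thesis .
qed

lemma compact_pos_lower_bound:
  fixes f :: "'a::topological_space \<Rightarrow> real"
  assumes "compact K" "continuous_on K f" "\<And>x. x \<in> K \<Longrightarrow> f x > 0"
  obtains c where "c > 0" "\<And>x. x \<in> K \<Longrightarrow> c \<le> f x"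
proof (cases "K = {}")
  case False
  then obtain x where "x \<in> K" "\<And>y. y \<in> K \<Longrightarrow> f x \<le> f y"
    using continuous_attains_inf[OF assms(1) _ assms(2)] by blast
  then show ?thesis using assms(3) that by blast
qed (use that[of 1] in auto)

lemma compact_norm_upper_bound:
  assumes "compact K" "continuous_on K f"
  obtains c :: real where "c > 0" "\<And>x. x \<in> K \<Longrightarrow> norm (f x) \<le> c"
  using compact_imp_bounded[OF compact_continuous_image[OF assms(2,1)]] that
  unfolding bounded_pos by auto

text \<open>\<open>surface_measure_on\<close> does not state finiteness; it comes from boundedness
  of the area element on compact subsets of a chart.\<close>

lemma emeasure_surface_compact_finite:
  assumes S: "closed S" and \<nu>: "surface_measure_on S \<nu>" and patch: "C2_patch S V \<Phi>"
    and K: "compact K" "K \<subseteq> V"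
  shows "emeasure \<nu> (\<Phi> ` K) < \<infinity>"
proof -
  have area: "continuous_on K (area_element \<Phi>)"
    using C1_on_imp_continuous_on[OF C1_on_area_element[OF patch]] K(2) continuous_on_subset by blast
  obtain c where c: "c > 0" "\<And>y. y \<in> K \<Longrightarrow> norm (area_element \<Phi> y) \<le> c"
    using compact_norm_upper_bound[OF K(1) area] by blast
  have inj: "inj_on \<Phi> V"
  proof -
    obtain \<rho> where "homeomorphism V (\<Phi> ` V) \<Phi> \<rho>" using patch unfolding C2_patch_def by blast
    then show ?thesis by (intro inj_on_inverseI[of V \<rho>]) (simp add: homeomorphism_def)
  qed
  have Kb: "K \<in> sets borel" using K(1) borel_compact by blast
  have "compact (\<Phi> ` K)"
    using C2_patch_continuous_on[OF patch] K compact_continuous_image continuous_on_subset by blast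
  then have "emeasure \<nu> (\<Phi> ` K) = (\<integral>\<^sup>+y\<in>V. (ennreal (area_element \<Phi> y) * indicator (\<Phi> ` K) (\<Phi> y)) \<partial>lborel)"
    using K(2) by (intro surface_measure_on_patch[OF \<nu> patch]) (auto intro: borel_compact)
  also have "\<dots> \<le> (\<integral>\<^sup>+y. ennreal c * indicator K y \<partial>lborel)"
  proof (intro nn_integral_mono)
    fix y
    show "ennreal (area_element \<Phi> y) * indicator (\<Phi> ` K) (\<Phi> y) * indicator V y \<le> ennreal c * indicator K y"
    proof (cases "y \<in> V \<and> \<Phi> y \<in> \<Phi> ` K")
      case True
      then have "y \<in> K" using inj K(2) by (auto simp: inj_on_def)
      then show ?thesis using c(2)[of y] True by (auto intro: ennreal_leI)
    qed auto
  qed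
  also have "\<dots> = ennreal c * emeasure lborel K"
    using Kb by (simp add: nn_integral_cmult_indicator)
  also have "\<dots> < \<infinity>"
    using emeasure_bounded_finite[OF compact_imp_bounded[OF K(1)]] by (simp add: ennreal_mult_less_top)
  finally show ?thesis .
qed

text \<open>Turns measure bounds on the surface into Lebesgue bounds in the chart. Intersecting
  \<open>X\<close> with the patch, instead of taking the image of \<open>B\<close>, avoids
  measurability of images.\<close>

lemma emeasure_chart_le:
  assumes S: "closed S" and \<nu>: "surface_measure_on S \<nu>" and patch: "C2_patch S V \<Phi>"
    and "K \<subseteq> V" and c: "c > 0" "\<And>y. y \<in> K \<Longrightarrow> c \<le> area_element \<Phi> y"
    and X: "X \<in> sets borel" and B: "B \<in> sets borel" "B \<subseteq> K" "\<And>y. y \<in> B \<Longrightarrow> \<Phi> y \<in> X"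
  shows "ennreal c * emeasure lborel B \<le> emeasure \<nu> X"
proof -
  have im: "\<Phi> ` V \<in> sets borel" using C2_patch_image_borel[OF S patch] by simp
  have "ennreal c * emeasure lborel B = (\<integral>\<^sup>+y. ennreal c * indicator B y \<partial>lborel)"
    using B(1) by (simp add: nn_integral_cmult_indicator)
  also have "\<dots> \<le> (\<integral>\<^sup>+y\<in>V. (ennreal (area_element \<Phi> y) * indicator (X \<inter> \<Phi> ` V) (\<Phi> y)) \<partial>lborel)"
    using B \<open>K \<subseteq> V\<close> c by (intro nn_integral_mono) (auto simp: indicator_def intro!: ennreal_leI)
  also have "\<dots> = emeasure \<nu> (X \<inter> \<Phi> ` V)"
    using X im by (intro surface_measure_on_patch[OF \<nu> patch, symmetric]) auto
  also have "\<dots> \<le> emeasure \<nu> X"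
    using X surface_measure_on_sets[OF \<nu>] by (intro emeasure_mono) auto
  finally show ?thesis .
qed

subsection \<open>Oscillatory integrals with convex phase\<close>

text \<open>Integrate by parts with amplitude \<open>W\<close> = B/g'. The derivative of 1/g'
  involves g'', but g'' \<ge> 0 lets g''/g'^2 be integrated exactly to 1/g'(a) - 1/g'(b), which is
  at most 1/m. Hence no upper bound for g'' enters the estimate.\<close>

lemma van_der_corput_first_derivative:
  fixes g g' g'' B B' :: "real \<Rightarrow> real"
  assumes "a \<le> b" and "l \<noteq> 0" and "m > 0"
    and g: "\<And>s. s \<in> {a..b} \<Longrightarrow> (g has_real_derivative g' s) (at s)"
    and g': "\<And>s. s \<in> {a..b} \<Longrightarrow> (g' has_real_derivative g'' s) (at s)"
    and g''_cont: "continuous_on {a..b} g''"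
    and g''_nonneg: "\<And>s. s \<in> {a..b} \<Longrightarrow> g'' s \<ge> 0"
    and g'_ge: "\<And>s. s \<in> {a..b} \<Longrightarrow> g' s \<ge> m"
    and B: "\<And>s. s \<in> {a..b} \<Longrightarrow> (B has_real_derivative B' s) (at s)"
    and B'_cont: "continuous_on {a..b} B'"
    and B_le: "\<And>s. s \<in> {a..b} \<Longrightarrow> \<bar>B s\<bar> \<le> M"
    and B'_le: "\<And>s. s \<in> {a..b} \<Longrightarrow> \<bar>B' s\<bar> \<le> M"
  shows "norm (integral {a..b} (\<lambda>s. B s *\<^sub>R cis (l * g s))) \<le> M * (3 + (b - a)) / (\<bar>l\<bar> * m)"
proof -
  define W where "W s = B s / g' s" for s
  define W' where "W' s = B' s / g' s - B s * g'' s / (g' s)\<^sup>2" for s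
  define F where "F s = (W s / l) *\<^sub>R (- \<i> * cis (l * g s))" for s
  define R where "R s = (W' s / l) *\<^sub>R (- \<i> * cis (l * g s))" for s
  have M: "M \<ge> 0" using B_le[of a] \<open>a \<le> b\<close> by (smt (verit) atLeastAtMost_iff)
  have g'_pos: "g' s > 0" if "s \<in> {a..b}" for s using g'_ge[OF that] \<open>m > 0\<close> by linarith
  have inv_g': "((\<lambda>s. - (1 / g' s)) has_real_derivative g'' s / (g' s)\<^sup>2) (at s)" if "s \<in> {a..b}" for s
    using g'_pos[OF that] by (auto intro!: derivative_eq_intros g'[OF that] simp: power2_eq_square)
  have W: "(W has_real_derivative W' s) (at s)" if "s \<in> {a..b}" for s
    unfolding W_def W'_def using g'_pos[OF that]
    by (auto intro!: derivative_eq_intros B[OF that] g'[OF that] simp: power2_eq_square field_simps)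
  have contg: "continuous_on {a..b} g" "continuous_on {a..b} g'" "continuous_on {a..b} B"
    by (auto intro!: continuous_at_imp_continuous_on DERIV_isCont g g' B)
  have contW': "continuous_on {a..b} W'"
    unfolding W'_def using g'_pos by (intro continuous_intros contg B'_cont g''_cont) force+
  have contR: "continuous_on {a..b} R"
    unfolding R_def by (intro continuous_intros contW' contg) (use \<open>l \<noteq> 0\<close> in auto)
  have cis_der: "((\<lambda>s. cis (l * g s)) has_vector_derivative (l * g' s) *\<^sub>R (\<i> * cis (l * g s))) (at s)"
    if "s \<in> {a..b}" for s
    unfolding has_vector_derivative_def
    by (rule has_derivative_eq_rhs[OF has_derivative_cis[OF has_derivative_mult_right[OF g[OF that, unfolded has_field_derivative_def]]]])
       (auto simp: fun_eq_iff mult_ac)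
  have F: "(F has_vector_derivative B s *\<^sub>R cis (l * g s) + R s) (at s)" if "s \<in> {a..b}" for s
  proof -
    have "((\<lambda>s. W s / l) has_real_derivative W' s / l) (at s)"
      using \<open>l \<noteq> 0\<close> by (auto intro!: derivative_eq_intros W[OF that])
    then have "(F has_vector_derivative (W s / l) *\<^sub>R (- \<i> * ((l * g' s) *\<^sub>R (\<i> * cis (l * g s)))) + R s) (at s)"
      unfolding F_def R_def
      by (intro has_vector_derivative_scaleR has_vector_derivative_mult_right cis_der that)
    moreover have "(W s / l) *\<^sub>R (- \<i> * ((l * g' s) *\<^sub>R (\<i> * cis (l * g s)))) = B s *\<^sub>R cis (l * g s)"
      using \<open>l \<noteq> 0\<close> g'_pos[OF that] by (simp add: W_def scaleR_conv_of_real field_simps)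
    ultimately show ?thesis by simp
  qed
  have "((\<lambda>s. B s *\<^sub>R cis (l * g s) + R s) has_integral F b - F a) {a..b}"
    by (rule fundamental_theorem_of_calculus[OF \<open>a \<le> b\<close> has_vector_derivative_at_within[OF F]])
  from has_integral_diff[OF this integrable_integral[OF integrable_continuous_interval[OF contR]]]
  have int_eq: "integral {a..b} (\<lambda>s. B s *\<^sub>R cis (l * g s)) = F b - F a - integral {a..b} R"
    by (simp add: integral_unique)
  have F_le: "norm (F s) \<le> M / (\<bar>l\<bar> * m)" if "s \<in> {a..b}" for s
  proof -
    have "norm (F s) = \<bar>B s\<bar> / (\<bar>l\<bar> * g' s)"
      using g'_pos[OF that] by (simp add: F_def W_def norm_mult abs_mult mult.commute)
    also have "\<dots> \<le> M / (\<bar>l\<bar> * m)"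
      using B_le[OF that] g'_ge[OF that] \<open>m > 0\<close> \<open>l \<noteq> 0\<close>
      by (intro frac_le mult_left_mono mult_pos_pos) auto
    finally show ?thesis .
  qed
  have "((\<lambda>s. g'' s / (g' s)\<^sup>2) has_integral (- (1 / g' b)) - (- (1 / g' a))) {a..b}"
    by (rule fundamental_theorem_of_calculus[OF \<open>a \<le> b\<close> has_vector_derivative_at_within[OF
        has_real_derivative_iff_has_vector_derivative[THEN iffD1, OF inv_g']]])
  from has_integral_add[OF has_integral_const_real[of "M / (\<bar>l\<bar> * m)" a b] has_integral_mult_right[OF this, of "M / \<bar>l\<bar>"]]
  have maj: "((\<lambda>s. M / (\<bar>l\<bar> * m) + M / \<bar>l\<bar> * (g'' s / (g' s)\<^sup>2)) has_integral
      (M / (\<bar>l\<bar> * m) * (b - a) + M / \<bar>l\<bar> * (1 / g' a - 1 / g' b))) {a..b}"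
    using \<open>a \<le> b\<close> by (simp add: mult.commute)
  have R_le: "norm (R s) \<le> M / (\<bar>l\<bar> * m) + M / \<bar>l\<bar> * (g'' s / (g' s)\<^sup>2)" if "s \<in> {a..b}" for s
  proof -
    have "norm (R s) = \<bar>W' s\<bar> / \<bar>l\<bar>" by (simp add: R_def norm_mult)
    also have "\<bar>W' s\<bar> \<le> \<bar>B' s\<bar> / g' s + \<bar>B s\<bar> * g'' s / (g' s)\<^sup>2"
      unfolding W'_def using g'_pos[OF that] g''_nonneg[OF that]
      by (intro order_trans[OF abs_triangle_ineq4]) (simp add: abs_mult)
    also have "\<dots> \<le> M / m + M * g'' s / (g' s)\<^sup>2"
      using g'_ge[OF that] B_le[OF that] B'_le[OF that] \<open>m > 0\<close> g''_nonneg[OF that]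
      by (intro add_mono frac_le divide_right_mono mult_right_mono) auto
    finally show ?thesis using \<open>l \<noteq> 0\<close> \<open>m > 0\<close> by (simp add: field_simps)
  qed
  have R_int: "norm (integral {a..b} R) \<le> M / (\<bar>l\<bar> * m) * (b - a) + M / \<bar>l\<bar> * (1 / g' a - 1 / g' b)"
    using integral_norm_bound_integral[OF integrable_continuous_interval[OF contR] has_integral_integrable[OF maj] R_le]
    by (simp only: integral_unique[OF maj])
  have "1 / g' a - 1 / g' b \<le> 1 / m"
  proof -
    have "1 / g' a \<le> 1 / m" using g'_ge[of a] \<open>m > 0\<close> \<open>a \<le> b\<close> by (intro frac_le) auto
    moreover have "1 / g' b \<ge> 0" using g'_pos[of b] \<open>a \<le> b\<close> by simp
    ultimately show ?thesis by linarith
  qed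
  then have "M / \<bar>l\<bar> * (1 / g' a - 1 / g' b) \<le> M / \<bar>l\<bar> * (1 / m)"
    using M by (intro mult_left_mono) auto
  with R_int have "norm (integral {a..b} R) \<le> M / (\<bar>l\<bar> * m) * (b - a) + M / \<bar>l\<bar> * (1 / m)"
    by linarith
  then have "norm (integral {a..b} (\<lambda>s. B s *\<^sub>R cis (l * g s))) \<le>
      M / (\<bar>l\<bar> * m) + M / (\<bar>l\<bar> * m) + (M / (\<bar>l\<bar> * m) * (b - a) + M / \<bar>l\<bar> * (1 / m))"
    unfolding int_eq using F_le[of a] F_le[of b] \<open>a \<le> b\<close>
    by (intro order_trans[OF norm_triangle_ineq4] add_mono) auto
  \<comment> \<open>The 3 counts two boundary terms and the exactly integrated g'' term; b - a comes
    from the B' term.\<close>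
  also have "\<dots> = M * (3 + (b - a)) / (\<bar>l\<bar> * m)"
    by (simp add: add_divide_distrib diff_divide_distrib algebra_simps)
  finally show ?thesis .
qed

section \<open>Averages over dilations\<close>

lemma lborel_integral_dilation:
  fixes G :: "'a::euclidean_space \<Rightarrow> 'b::euclidean_space"
  assumes G: "integrable lborel G" and "s \<noteq> 0"
  shows "integrable lborel (\<lambda>y. G (y0 + s *\<^sub>R (y - y0)))"
    and "integral\<^sup>L lborel G = \<bar>s\<bar> ^ DIM('a) *\<^sub>R (\<integral>y. G (y0 + s *\<^sub>R (y - y0)) \<partial>lborel)"
proof -
  have meas: "(\<lambda>x. (y0 - s *\<^sub>R y0) + s *\<^sub>R x) \<in> borel_measurable borel" by measurable
  have eq: "(y0 - s *\<^sub>R y0) + s *\<^sub>R y = y0 + s *\<^sub>R (y - y0)" for y by (simp add: algebra_simps)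
  have [measurable]: "G \<in> borel_measurable borel" using G by auto
  note L = lborel_affine[OF \<open>s \<noteq> 0\<close>, of "y0 - s *\<^sub>R y0"]
  have "integrable lborel (\<lambda>x. \<bar>s\<bar> ^ DIM('a) *\<^sub>R G ((y0 - s *\<^sub>R y0) + s *\<^sub>R x))"
    using G by (subst (asm) L) (simp add: integrable_density integrable_distr_eq)
  then show "integrable lborel (\<lambda>y. G (y0 + s *\<^sub>R (y - y0)))"
    using integrable_scaleR_right[of "inverse (\<bar>s\<bar> ^ DIM('a))" lborel "\<lambda>x. \<bar>s\<bar> ^ DIM('a) *\<^sub>R G (y0 + s *\<^sub>R (x - y0))"] \<open>s \<noteq> 0\<close>
    by (simp add: eq)
  show "integral\<^sup>L lborel G = \<bar>s\<bar> ^ DIM('a) *\<^sub>R (\<integral>y. G (y0 + s *\<^sub>R (y - y0)) \<partial>lborel)"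
    by (subst L) (simp add: integral_density integral_distr eq)
qed

text \<open>Each dilation, weighted by its Jacobian \<open>s ^ DIM('a)\<close>, preserves the
  integral, and \<open>{1..2}\<close> has length 1, so the average needs no normalising factor.
  Fubini moves the integral over s inside.\<close>

lemma lborel_integral_dilation_average:
  fixes G :: "'a::euclidean_space \<Rightarrow> 'b::euclidean_space" and y0 :: 'a
  assumes G: "integrable lborel G"
  defines "I \<equiv> \<lambda>y. \<integral>s. indicator {1..2} s *\<^sub>R (s ^ DIM('a) *\<^sub>R G (y0 + s *\<^sub>R (y - y0))) \<partial>lborel"
  shows "integrable lborel I" "integral\<^sup>L lborel I = integral\<^sup>L lborel G"
proof -
  let ?f = "\<lambda>(s::real, y). indicator {1..2} s *\<^sub>R (s ^ DIM('a) *\<^sub>R G (y0 + s *\<^sub>R (y - y0)))"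
  have Gm [measurable]: "G \<in> borel_measurable borel" using G by auto
  have inner: "integrable lborel (\<lambda>y. ?f (s, y))" for s
    using lborel_integral_dilation(1)[OF G, of s y0] by (cases "s \<in> {1..2}") auto
  have val: "(\<integral>y. ?f (s, y) \<partial>lborel) = indicator {1..2} s *\<^sub>R integral\<^sup>L lborel G" for s
    using lborel_integral_dilation(2)[OF G, of s y0] by (cases "s \<in> {1..2}") auto
  have nval: "(\<integral>y. norm (?f (s, y)) \<partial>lborel) = indicator {1..2} s *\<^sub>R (\<integral>y. norm (G y) \<partial>lborel)" for s
    using lborel_integral_dilation(2)[OF integrable_norm[OF G], of s y0] by (cases "s \<in> {1..2}") auto
  have int: "integrable (lborel \<Otimes>\<^sub>M lborel) ?f"
  proof (rule lborel_pair.Fubini_integrable)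
    show "?f \<in> borel_measurable (lborel \<Otimes>\<^sub>M lborel)" by measurable
    show "integrable lborel (\<lambda>x. \<integral>y. norm (?f (x, y)) \<partial>lborel)"
      unfolding nval by (rule integrable_scaleR_left) auto
    show "AE x in lborel. integrable lborel (\<lambda>y. ?f (x, y))" using inner by auto
  qed
  show "integrable lborel I"
    using lborel_pair.integrable_snd[of "\<lambda>s y. ?f (s, y)"] int by (simp add: I_def)
  have "integral\<^sup>L lborel I = (\<integral>s. \<integral>y. ?f (s, y) \<partial>lborel \<partial>lborel)"
    using lborel_pair.Fubini_integral[of "\<lambda>s y. ?f (s, y)"] int by (simp add: I_def)
  also have "\<dots> = integral\<^sup>L lborel G" unfolding val by simp
  finally show "integral\<^sup>L lborel I = integral\<^sup>L lborel G" .
qed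

text \<open>On a ray issuing from the minimum of \<open>f\<close>, the radial derivative of the convex function \<open>f\<close>
  is at least its increment, so that the average over the dilations \<open>1 \<le> s \<le> 2\<close> is a
  one-dimensional oscillatory integral without stationary points.\<close>

lemma convex_ray_integral_bound:
  fixes f A :: "'a::euclidean_space \<Rightarrow> real" and N :: nat and M0 M1 :: real
  assumes V: "open V" and f: "C2_on f V" "convex_on V f" and A: "C1_on A V"
    and K: "compact K" "convex K" "K \<subseteq> V"
    and y0: "y0 \<in> K" "\<And>y. y \<in> K \<Longrightarrow> f y0 \<le> f y" and "l \<noteq> 0"
    and M0: "\<And>y. y \<in> K \<Longrightarrow> \<bar>A y\<bar> \<le> M0"
    and M1: "\<And>y. y \<in> K \<Longrightarrow> norm (frechet_derivative A (at y) d) \<le> M1"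
    and d: "y = y0 + d"
  defines "M \<equiv> 2 ^ N * (N * M0 + M0 + M1)"
    and "I \<equiv> \<integral>s. indicator {1..2} s *\<^sub>R (s ^ N *\<^sub>R (indicator K (y0 + s *\<^sub>R d) *\<^sub>R (A (y0 + s *\<^sub>R d) *\<^sub>R cis (l * f (y0 + s *\<^sub>R d))))) \<partial>lborel"
  shows "y \<notin> K \<Longrightarrow> I = 0" "norm I \<le> 4 * M" "y \<in> K \<Longrightarrow> f y0 < f y \<Longrightarrow> norm I \<le> 4 * M / (\<bar>l\<bar> * (f y - f y0))"
proof -
  have M0_nonneg: "M0 \<ge> 0" using M0[OF y0(1)] by linarith
  have M1_nonneg: "M1 \<ge> 0" using M1[OF y0(1)] norm_ge_zero order_trans by blast
  have M_nonneg: "M \<ge> 0" unfolding M_def using M0_nonneg M1_nonneg by simp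
  have down: "y0 + r *\<^sub>R d \<in> K" if "y0 + s *\<^sub>R d \<in> K" "0 \<le> r" "r \<le> s" for r s
  proof (cases "s = 0")
    case False
    have "y0 + r *\<^sub>R d = (1 - r / s) *\<^sub>R y0 + (r / s) *\<^sub>R (y0 + s *\<^sub>R d)"
      using False by (simp add: algebra_simps)
    also have "\<dots> \<in> K" using that False by (intro convexD[OF K(2)] y0) auto
    finally show ?thesis .
  qed (use that in auto)
  show zero: "I = 0" if "y \<notin> K"
  proof -
    have "indicator {1..2} s *\<^sub>R (s ^ N *\<^sub>R (indicator K (y0 + s *\<^sub>R d) *\<^sub>R (A (y0 + s *\<^sub>R d) *\<^sub>R cis (l * f (y0 + s *\<^sub>R d))))) = 0" for s
      using down[of s 1] that d by (auto simp: indicator_def)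
    then show ?thesis unfolding I_def by (intro integral_eq_zero_AE always_eventually allI)
  qed
  have main: "norm I \<le> 4 * M \<and> (f y0 < f y \<longrightarrow> norm I \<le> 4 * M / (\<bar>l\<bar> * (f y - f y0)))" if yK: "y \<in> K"
  proof -
    \<comment> \<open>The scales at which the ray is still in \<open>K\<close>. As \<open>K\<close>
      is star-shaped about \<open>y0\<close> and contains \<open>y\<close>, they form an interval
      \<open>{1..b}\<close> with b \<le> 2, so the sharp cut-off at \<open>K\<close> only moves the
      upper end point.\<close>
    define T where "T = {1..2} \<inter> (\<lambda>s. y0 + s *\<^sub>R d) -` K"
    have "closed ((\<lambda>s. y0 + s *\<^sub>R d) -` K)"
      by (intro closed_vimage compact_imp_closed K continuous_intros)
    then have "compact T" unfolding T_def by (intro compact_Int_closed) auto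
    moreover have "connected T"
      unfolding is_interval_connected_1[symmetric] is_interval_1 T_def
    proof clarsimp
      fix a b x assume "y0 + b *\<^sub>R d \<in> K" "1 \<le> a" "a \<le> x" "x \<le> b"
      then show "y0 + x *\<^sub>R d \<in> K" using down[of b x] by auto
    qed
    ultimately obtain a b where ab: "T = {a..b}" using connected_compact_interval_1 by blast
    have "1 \<in> T" using yK d by (simp add: T_def)
    then have "a \<le> 1" "1 \<le> b" using ab by auto
    then have "a \<in> T" "b \<in> T" using ab by auto
    then have "1 \<le> a" "b \<le> 2" by (simp_all add: T_def)
    with \<open>a \<le> 1\<close> have "a = 1" by simp
    note T = ab[unfolded \<open>a = 1\<close>]
    have inK: "y0 + s *\<^sub>R d \<in> K" if "s \<in> {1..b}" for s
    proof -
      have "s \<in> T" using that T by simp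
      then show ?thesis by (simp add: T_def)
    qed
    have inV: "y0 + s *\<^sub>R d \<in> V" if "s \<in> {1..b}" for s using inK[OF that] K(3) by blast
    obtain f' where f': "\<And>x. x \<in> V \<Longrightarrow> (f has_derivative blinfun_apply (f' x)) (at x)" "C1_on f' V"
      using f(1) unfolding C2_on_def by blast
    obtain f'' where f'': "\<And>x. x \<in> V \<Longrightarrow> (f' has_derivative blinfun_apply (f'' x)) (at x)" "continuous_on V f''"
      using f'(2) unfolding C1_on_def by blast
    obtain A' where A': "\<And>x. x \<in> V \<Longrightarrow> (A has_derivative blinfun_apply (A' x)) (at x)" "continuous_on V A'"
      using A unfolding C1_on_def by blast
    define g where "g s = f (y0 + s *\<^sub>R d)" for s
    define g' where "g' s = f' (y0 + s *\<^sub>R d) d" for s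
    define g'' where "g'' s = f'' (y0 + s *\<^sub>R d) d d" for s
    \<comment> \<open>An open interval containing 0 besides \<open>{1..b}\<close>: tangent lines on
      the range of integration are compared with the value of g at the minimum, s = 0.\<close>
    define J where "J = (\<lambda>s. y0 + s *\<^sub>R d) -` V"
    have contl: "continuous_on X (\<lambda>s. y0 + s *\<^sub>R d)" for X by (intro continuous_intros)
    have "open J" unfolding J_def by (intro open_vimage V contl)
    have J: "{1..b} \<subseteq> J" "0 \<in> J" using inV y0 K(3) by (auto simp: J_def)
    have line: "((\<lambda>s. y0 + s *\<^sub>R d) has_derivative (\<lambda>h. h *\<^sub>R d)) (at s)" for s
      by (auto intro!: derivative_eq_intros)
    have g: "(g has_real_derivative g' s) (at s)" if "s \<in> J" for s
      unfolding has_field_derivative_def g_def g'_def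
      by (rule has_derivative_eq_rhs[OF has_derivative_compose[OF line f'(1)]])
         (use that in \<open>auto simp: J_def blinfun.scaleR_right fun_eq_iff\<close>)
    have g': "(g' has_real_derivative g'' s) (at s)" if "s \<in> J" for s
    proof -
      have "((\<lambda>s. f' (y0 + s *\<^sub>R d)) has_derivative (\<lambda>h. f'' (y0 + s *\<^sub>R d) (h *\<^sub>R d))) (at s)"
        by (rule has_derivative_compose[OF line f''(1)]) (use that in \<open>auto simp: J_def\<close>)
      from bounded_linear.has_derivative[OF blinfun.bounded_linear_left this]
      show ?thesis
        unfolding has_field_derivative_def g''_def g'_def
        by (rule has_derivative_eq_rhs) (auto simp: blinfun.scaleR_right blinfun.scaleR_left fun_eq_iff)
    qed
    have cg'': "continuous_on {1..b} g''"
      unfolding g''_def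
      by (intro continuous_intros continuous_on_compose2[OF f''(2) contl]) (use inV in auto)
    have "convex V" using f(2) by (simp add: convex_on_def)
    have cJ: "convex J"
    proof (rule convexI)
      fix x z u v :: real assume *: "x \<in> J" "z \<in> J" "0 \<le> u" "0 \<le> v" "u + v = 1"
      have "y0 + (u *\<^sub>R x + v *\<^sub>R z) *\<^sub>R d = (u + v) *\<^sub>R y0 + (u *\<^sub>R x + v *\<^sub>R z) *\<^sub>R d" using *(5) by simp
      also have "\<dots> = u *\<^sub>R (y0 + x *\<^sub>R d) + v *\<^sub>R (y0 + z *\<^sub>R d)" by (simp add: algebra_simps)
      also have "\<dots> \<in> V" using * by (intro convexD[OF \<open>convex V\<close>]) (auto simp: J_def)
      finally show "u *\<^sub>R x + v *\<^sub>R z \<in> J" by (simp add: J_def)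
    qed
    have convg: "convex_on J g"
    proof (rule convex_onI[OF _ cJ])
      fix t x z :: real assume *: "0 < t" "t < 1" "x \<in> J" "z \<in> J"
      have "y0 + ((1 - t) *\<^sub>R x + t *\<^sub>R z) *\<^sub>R d = (1 - t) *\<^sub>R (y0 + x *\<^sub>R d) + t *\<^sub>R (y0 + z *\<^sub>R d)"
        by (simp add: algebra_simps)
      then show "g ((1 - t) *\<^sub>R x + t *\<^sub>R z) \<le> (1 - t) * g x + t * g z"
        unfolding g_def using convex_onD[OF f(2), of t "y0 + x *\<^sub>R d" "y0 + z *\<^sub>R d"] * by (auto simp: J_def)
    qed
    have tangent: "g x - g c \<ge> g' c * (x - c)" if "x \<in> J" "c \<in> J" for x c
      using that \<open>open J\<close>
      by (intro convex_on_imp_above_tangent[OF convg convex_connected[OF cJ] _ _ has_field_derivative_at_within[OF g]])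
         (auto simp: interior_open)
    have mono: "mono_on J g'"
    proof (rule mono_onI)
      fix r s assume rs: "r \<in> J" "s \<in> J" "r \<le> s"
      show "g' r \<le> g' s"
      proof (cases "r = s")
        case False
        have "g' r * (s - r) + g' s * (r - s) \<le> 0" using tangent[of s r] tangent[of r s] rs by linarith
        then have "(g' r - g' s) * (s - r) \<le> 0" by (simp add: algebra_simps)
        then show ?thesis using False rs by (auto simp: mult_le_0_iff)
      qed simp
    qed
    have g''_nonneg: "g'' s \<ge> 0" if "s \<in> {1..b}" for s
      using mono_on_imp_deriv_nonneg[OF mono g'[of s]] that J(1) \<open>open J\<close> by (auto simp: interior_open)
    have g1: "g 1 = f y" "g 0 = f y0" by (auto simp: g_def d)
    \<comment> \<open>The tangent at s, read at 0, gives s g'(s) \<ge> g(s) - g(0). Convexity, with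
      1 between 0 and s, gives g(s) - g(0) \<ge> s (g(1) - g(0)). Dividing by s leaves the increment
      of f from \<open>y0\<close> to \<open>y\<close>.\<close>
    have g'_ge: "g' s \<ge> f y - f y0" if s: "s \<in> {1..b}" for s
    proof -
      have s1: "s \<ge> 1" using s by auto
      have ineq: "g 0 - g s \<ge> g' s * (0 - s)" using tangent s J by blast
      have "g ((1 - 1 / s) *\<^sub>R 0 + (1 / s) *\<^sub>R s) \<le> (1 - 1 / s) * g 0 + (1 / s) * g s"
        using s1 s J by (intro convex_onD[OF convg]) auto
      then have "s * g 1 \<le> (s - 1) * g 0 + g s"
        using s1 by (simp add: field_simps)
      then have "s * (g 1 - g 0) \<le> g s - g 0" by (simp add: algebra_simps)
      also have "\<dots> \<le> s * g' s" using ineq by (simp add: algebra_simps)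
      finally have "s * (g 1 - g 0) \<le> s * g' s" .
      then show ?thesis using s1 g1 by simp
    qed
    \<comment> \<open>The amplitude along the ray, including the Jacobian. The constant
      \<open>M\<close> bounds both B, by 2^N M0, and B', where N M0 comes from differentiating s^N
      and M1 from differentiating A; the factor 2^N is due to s \<le> 2.\<close>
    define B where "B s = s ^ N * A (y0 + s *\<^sub>R d)" for s
    define B' where "B' s = real N * s ^ (N - 1) * A (y0 + s *\<^sub>R d) + s ^ N * blinfun_apply (A' (y0 + s *\<^sub>R d)) d" for s :: real
    have Ader: "((\<lambda>s. A (y0 + s *\<^sub>R d)) has_real_derivative A' (y0 + s *\<^sub>R d) d) (at s)" if "s \<in> {1..b}" for s
      unfolding has_field_derivative_def
      by (rule has_derivative_eq_rhs[OF has_derivative_compose[OF line A'(1)]])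
         (use inV[OF that] in \<open>auto simp: blinfun.scaleR_right fun_eq_iff\<close>)
    have B: "(B has_real_derivative B' s) (at s)" if "s \<in> {1..b}" for s
      unfolding B_def B'_def by (auto intro!: derivative_eq_intros Ader[OF that])
    have cA: "continuous_on {1..b} (\<lambda>s. A (y0 + s *\<^sub>R d))"
      by (intro continuous_on_compose2[OF C1_on_imp_continuous_on[OF A] contl]) (use inV in auto)
    have cB': "continuous_on {1..b} B'"
      unfolding B'_def
      by (intro continuous_intros cA continuous_on_compose2[OF A'(2) contl]) (use inV in auto)
    have cB: "continuous_on {1..b} B" unfolding B_def by (intro continuous_intros cA)
    have pow: "s ^ k \<le> 2 ^ N" "0 \<le> s ^ k" if "s \<in> {1..b}" "k \<le> N" for s :: real and k
    proof -
      have "s ^ k \<le> 2 ^ k" using that \<open>b \<le> 2\<close> by (intro power_mono) auto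
      also have "\<dots> \<le> 2 ^ N" using that by (intro power_increasing) auto
      finally show "s ^ k \<le> 2 ^ N" .
      show "0 \<le> s ^ k" using that by auto
    qed
    have B_le0: "\<bar>B s\<bar> \<le> 2 ^ N * M0" if "s \<in> {1..b}" for s
      unfolding B_def abs_mult using pow[OF that, of N] M0[OF inK[OF that]] by (intro mult_mono) auto
    have le0: "2 ^ N * M0 \<le> M"
      unfolding M_def using M0_nonneg M1_nonneg by (intro mult_left_mono) auto
    have B_le: "\<bar>B s\<bar> \<le> M" if "s \<in> {1..b}" for s
      using B_le0[OF that] le0 by linarith
    have B'_le: "\<bar>B' s\<bar> \<le> M" if s: "s \<in> {1..b}" for s
    proof -
      have A1: "\<bar>A' (y0 + s *\<^sub>R d) d\<bar> \<le> M1"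
        using M1[OF inK[OF s]] frechet_derivative_at[OF A'(1)[OF inV[OF s]]] by simp
      have "\<bar>B' s\<bar> \<le> real N * (\<bar>s ^ (N - 1)\<bar> * \<bar>A (y0 + s *\<^sub>R d)\<bar>) + \<bar>s ^ N\<bar> * \<bar>A' (y0 + s *\<^sub>R d) d\<bar>"
        unfolding B'_def by (rule order_trans[OF abs_triangle_ineq]) (simp add: abs_mult mult.assoc)
      also have "\<dots> \<le> real N * (2 ^ N * M0) + 2 ^ N * M1"
        using pow[OF s, of "N - 1"] pow[OF s, of N] M0[OF inK[OF s]] A1
        by (intro add_mono mult_left_mono mult_mono) auto
      also have "\<dots> \<le> M" unfolding M_def using M0_nonneg by (simp add: algebra_simps)
      finally show ?thesis .
    qed
    have cg: "continuous_on {1..b} g"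
      using g J by (intro continuous_at_imp_continuous_on) (auto intro: DERIV_isCont)
    have cBg: "continuous_on {1..b} (\<lambda>s. B s *\<^sub>R cis (l * g s))"
      by (intro continuous_intros cB cg)
    have "I = (LINT s:{1..b}|lborel. B s *\<^sub>R cis (l * g s))"
      unfolding I_def set_lebesgue_integral_def
    proof (intro Bochner_Integration.integral_cong refl)
      fix s :: real
      have "s \<in> {1..2} \<and> y0 + s *\<^sub>R d \<in> K \<longleftrightarrow> s \<in> {1..b}"
        unfolding T[symmetric] by (simp add: T_def)
      then show "indicator {1..2} s *\<^sub>R (s ^ N *\<^sub>R (indicator K (y0 + s *\<^sub>R d) *\<^sub>R (A (y0 + s *\<^sub>R d) *\<^sub>R cis (l * f (y0 + s *\<^sub>R d)))))
        = indicator {1..b} s *\<^sub>R (B s *\<^sub>R cis (l * g s))"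
        by (auto simp: B_def g_def indicator_def)
    qed
    also have "\<dots> = integral {1..b} (\<lambda>s. B s *\<^sub>R cis (l * g s))"
      by (rule set_borel_integral_eq_integral(2)[OF borel_integrable_atLeastAtMost'[OF cBg]])
    finally have I: "I = integral {1..b} (\<lambda>s. B s *\<^sub>R cis (l * g s))" .
    \<comment> \<open>The trivial bound is relaxed to \<open>4 * M\<close> so that both estimates
      share one constant, as \<open>nn_integral_sublevel_decay\<close> expects; the 4 itself is 3 +
      (b - 1) at b = 2.\<close>
    have "norm I \<le> 2 ^ N * M0 * (b - 1)"
      unfolding I using B_le0 by (intro integral_bound \<open>1 \<le> b\<close> cBg) auto
    also have "\<dots> \<le> M * 1" using le0 \<open>1 \<le> b\<close> \<open>b \<le> 2\<close> M_nonneg by (intro mult_mono) auto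
    finally have "norm I \<le> 4 * M" using M_nonneg by linarith
    moreover have "norm I \<le> 4 * M / (\<bar>l\<bar> * (f y - f y0))" if "f y0 < f y"
    proof -
      have "norm I \<le> M * (3 + (b - 1)) / (\<bar>l\<bar> * (f y - f y0))"
        unfolding I
        by (rule van_der_corput_first_derivative[OF \<open>1 \<le> b\<close> \<open>l \<noteq> 0\<close> _ g g' cg'' g''_nonneg g'_ge B cB' B_le B'_le])
           (use J that in auto)
      also have "\<dots> \<le> M * 4 / (\<bar>l\<bar> * (f y - f y0))"
        using \<open>b \<le> 2\<close> M_nonneg that by (intro divide_right_mono mult_left_mono) auto
      finally show ?thesis by (simp add: mult.commute)
    qed
    ultimately show ?thesis by blast
  qed
  show "norm I \<le> 4 * M" using main zero M_nonneg by (cases "y \<in> K") auto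
  show "y \<in> K \<Longrightarrow> f y0 < f y \<Longrightarrow> norm I \<le> 4 * M / (\<bar>l\<bar> * (f y - f y0))" using main by blast
qed

text \<open>Pointwise, \<open>min 1 (1 / (T * F)) \<le> 2 * (\<Sum>k. 2 ^ (- k) * indicator {F \<le> 2 ^ k / T})\<close>; the exponent
  restriction \<open>\<alpha> < 1\<close> makes the resulting geometric series converge.\<close>

lemma nn_integral_sublevel_decay:
  fixes F h :: "'a \<Rightarrow> real"
  assumes F[measurable]: "F \<in> borel_measurable M" and K[measurable]: "K \<in> sets M"
    and "c \<ge> 0" "C \<ge> 0" "T > 0" "\<alpha> < 1"
    and h0: "\<And>y. y \<in> K \<Longrightarrow> h y \<le> c"
    and h1: "\<And>y. y \<in> K \<Longrightarrow> F y > 0 \<Longrightarrow> h y \<le> c / (T * F y)"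
    and sub: "\<And>s. s > 0 \<Longrightarrow> emeasure M {y\<in>space M. y \<in> K \<and> F y \<le> s} \<le> ennreal (C * s powr \<alpha>)"
  shows "(\<integral>\<^sup>+y. ennreal (h y) * indicator K y \<partial>M) \<le> ennreal (2 * c * C / (1 - 2 powr (\<alpha> - 1)) * T powr (- \<alpha>))"
proof -
  define q :: real where "q = 2 powr (\<alpha> - 1)"
  have q: "0 < q" "q < 1" using \<open>\<alpha> < 1\<close> by (auto simp: q_def powr_less_one)
  define E where "E k = {y\<in>space M. y \<in> K \<and> F y \<le> 2 ^ k / T}" for k :: nat
  have Em [measurable]: "E k \<in> sets M" for k unfolding E_def by measurable
  have "ennreal (h y) * indicator K y \<le> (\<Sum>k. ennreal (2 * c / 2 ^ k) * indicator (E k) y)" if "y \<in> space M" for y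
  proof (cases "y \<in> K")
    case True
    have "\<exists>k. h y \<le> 2 * c / 2 ^ k \<and> F y \<le> 2 ^ k / T"
    proof (cases "T * F y \<le> 1")
      case True
      then show ?thesis using h0[OF \<open>y \<in> K\<close>] \<open>c \<ge> 0\<close> \<open>T > 0\<close>
        by (intro exI[of _ 0]) (auto simp: field_simps)
    next
      case False
      \<comment> \<open>Minimality of k gives T F(y) > 2^(k-1), so the hyperbolic bound is at most c
        / 2^(k-1). This lost step is the factor 2 in the conclusion; the case T F(y) \<le> 1 is
        handled by k = 0.\<close>
      define k where "k = (LEAST k. T * F y \<le> 2 ^ k)"
      have ex: "\<exists>k. T * F y \<le> 2 ^ k" using real_arch_pow[of 2 "T * F y"] less_imp_le by fastforce
      have k: "T * F y \<le> 2 ^ k" unfolding k_def by (rule LeastI_ex[OF ex])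
      have "k \<noteq> 0" using k False by (cases k) auto
      then obtain j where j: "k = Suc j" by (cases k) auto
      have "\<not> T * F y \<le> 2 ^ j" using not_less_Least[of j "\<lambda>k. T * F y \<le> 2 ^ k"] j by (simp add: k_def)
      then have "c / (T * F y) \<le> c / 2 ^ j" using \<open>c \<ge> 0\<close> by (intro frac_le) auto
      moreover have "F y > 0" using False \<open>T > 0\<close> by (smt (verit) mult_nonneg_nonpos)
      ultimately have "h y \<le> 2 * c / 2 ^ k" using h1[OF \<open>y \<in> K\<close>] by (simp add: j)
      then show ?thesis using k \<open>T > 0\<close> by (intro exI[of _ k]) (auto simp: field_simps)
    qed
    then obtain k where k: "h y \<le> 2 * c / 2 ^ k" "F y \<le> 2 ^ k / T" by blast
    then have "ennreal (h y) * indicator K y \<le> (\<Sum>k\<in>{k}. ennreal (2 * c / 2 ^ k) * indicator (E k) y)"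
      using True that by (simp add: E_def ennreal_leI)
    also have "\<dots> \<le> (\<Sum>k. ennreal (2 * c / 2 ^ k) * indicator (E k) y)"
      by (intro sum_le_suminf) auto
    finally show ?thesis .
  qed simp
  then have "(\<integral>\<^sup>+y. ennreal (h y) * indicator K y \<partial>M) \<le> (\<integral>\<^sup>+y. (\<Sum>k. ennreal (2 * c / 2 ^ k) * indicator (E k) y) \<partial>M)"
    by (intro nn_integral_mono)
  also have "\<dots> = (\<Sum>k. ennreal (2 * c / 2 ^ k) * emeasure M (E k))"
    by (subst nn_integral_suminf) (auto simp: nn_integral_cmult_indicator)
  also have "\<dots> \<le> (\<Sum>k. ennreal (2 * c * C * T powr (- \<alpha>) * q ^ k))"
  proof (intro suminf_le allI)
    fix k
    have "ennreal (2 * c / 2 ^ k) * emeasure M (E k) \<le> ennreal (2 * c / 2 ^ k) * ennreal (C * (2 ^ k / T) powr \<alpha>)"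
      unfolding E_def using sub[of "2 ^ k / T"] \<open>T > 0\<close> by (intro mult_left_mono) auto
    also have "\<dots> = ennreal ((2 * c / 2 ^ k) * (C * (2 ^ k / T) powr \<alpha>))"
      using \<open>c \<ge> 0\<close> \<open>C \<ge> 0\<close> by (intro ennreal_mult[symmetric]) auto
    also have "(2 * c / 2 ^ k) * (C * (2 ^ k / T) powr \<alpha>) = 2 * c * C * T powr (- \<alpha>) * q ^ k"
    proof -
      have "(2 ^ k / T) powr \<alpha> = (2 powr \<alpha>) ^ k * T powr (- \<alpha>)"
        using \<open>T > 0\<close> by (simp add: powr_divide powr_minus_divide powr_realpow[symmetric] powr_powr mult.commute del: powr_realpow)
      moreover have "q ^ k = (2 powr \<alpha>) ^ k / 2 ^ k"
        by (simp add: q_def powr_diff power_divide)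
      ultimately show ?thesis by simp
    qed
    finally show "ennreal (2 * c / 2 ^ k) * emeasure M (E k) \<le> ennreal (2 * c * C * T powr (- \<alpha>) * q ^ k)" .
  qed auto
  also have "\<dots> = ennreal (\<Sum>k. 2 * c * C * T powr (- \<alpha>) * q ^ k)"
    using q \<open>c \<ge> 0\<close> \<open>C \<ge> 0\<close> by (intro suminf_ennreal2 summable_mult summable_geometric) auto
  also have "(\<Sum>k. 2 * c * C * T powr (- \<alpha>) * q ^ k) = 2 * c * C / (1 - q) * T powr (- \<alpha>)"
    using q by (subst suminf_mult) (auto simp: suminf_geometric summable_geometric)
  finally show ?thesis by (simp add: q_def)
qed

text \<open>The phase enters the constant only through its sublevel bound \<open>C\<close>; the
  remaining data \<open>M0\<close>, \<open>M1\<close> and \<open>D\<close> concern the amplitude and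
  \<open>K\<close>. This is what makes the estimate uniform over all directions in a chart.\<close>

lemma convex_oscillatory_integral_bound:
  fixes f A :: "'a::euclidean_space \<Rightarrow> real" and M0 M1 D :: real
  assumes V: "open V" and f: "C2_on f V" "convex_on V f" and A: "C1_on A V"
    and K: "compact K" "convex K" "K \<subseteq> V"
    and y0: "y0 \<in> K" "\<And>y. y \<in> K \<Longrightarrow> f y0 \<le> f y" and "l \<noteq> 0"
    and M0: "\<And>y. y \<in> K \<Longrightarrow> \<bar>A y\<bar> \<le> M0"
    and M1: "\<And>y. y \<in> K \<Longrightarrow> onorm (frechet_derivative A (at y)) \<le> M1"
    and D: "\<And>y. y \<in> K \<Longrightarrow> norm (y - y0) \<le> D"
    and "C \<ge> 0" "\<alpha> < 1"
    and sub: "\<And>s. s > 0 \<Longrightarrow> emeasure lborel {y\<in>K. f y \<le> f y0 + s} \<le> ennreal (C * s powr \<alpha>)"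
  defines "M \<equiv> 4 * (2 ^ DIM('a) * (DIM('a) * M0 + M0 + M1 * D))"
  shows "norm (\<integral>y. indicator K y *\<^sub>R (A y *\<^sub>R cis (l * f y)) \<partial>lborel) \<le> 2 * M * C / (1 - 2 powr (\<alpha> - 1)) * \<bar>l\<bar> powr (- \<alpha>)"
proof -
  define G where "G y = indicator K y *\<^sub>R (A y *\<^sub>R cis (l * f y))" for y
  define I where "I y = (\<integral>s. indicator {1..2} s *\<^sub>R (s ^ DIM('a) *\<^sub>R G (y0 + s *\<^sub>R (y - y0))) \<partial>lborel)" for y
  have contf: "continuous_on K f" "continuous_on K A"
    using C1_on_imp_continuous_on[OF C2_on_imp_C1_on[OF f(1)]] C1_on_imp_continuous_on[OF A] K(3) continuous_on_subset by blast+
  have [measurable]: "K \<in> sets borel" using K(1) by (simp add: borel_compact)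
  have G: "integrable lborel G"
    unfolding G_def by (intro borel_integrable_compact K continuous_intros contf)
  have M0_nonneg: "M0 \<ge> 0" using M0[OF y0(1)] by linarith
  have D_nonneg: "D \<ge> 0" using D[OF y0(1)] by simp
  have "onorm (frechet_derivative A (at y0)) \<ge> 0"
    using C1_on_imp_differentiable[OF A] y0(1) K(3) frechet_derivative_works has_derivative_bounded_linear onorm_pos_le by blast
  then have M1_nonneg: "M1 \<ge> 0" using M1[OF y0(1)] by linarith
  have M_nonneg: "M \<ge> 0" unfolding M_def using M0_nonneg M1_nonneg D_nonneg by simp
  have Iy: "(y \<notin> K \<longrightarrow> I y = 0) \<and> (y \<in> K \<longrightarrow> norm (I y) \<le> M) \<and> (y \<in> K \<longrightarrow> f y0 < f y \<longrightarrow> norm (I y) \<le> M / (\<bar>l\<bar> * (f y - f y0)))" for y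
  proof (cases "y \<in> K")
    case True
    have "norm (frechet_derivative A (at z) (y - y0)) \<le> M1 * D" if "z \<in> K" for z
    proof -
      have "bounded_linear (frechet_derivative A (at z))"
        using C1_on_imp_differentiable[OF A] that K(3) frechet_derivative_works has_derivative_bounded_linear by blast
      then have "norm (frechet_derivative A (at z) (y - y0)) \<le> onorm (frechet_derivative A (at z)) * norm (y - y0)"
        by (rule onorm)
      also have "\<dots> \<le> M1 * D" using M1[OF that] D[OF True] M1_nonneg by (intro mult_mono) auto
      finally show ?thesis .
    qed
    from convex_ray_integral_bound[OF V f A K y0 \<open>l \<noteq> 0\<close> M0 this, where y = y and N = "DIM('a)"] True
    show ?thesis by (auto simp: I_def G_def M_def)
  next
    case False
    have "y0 + s *\<^sub>R (y - y0) \<notin> K" if "s \<in> {1..2}" for s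
    proof
      assume *: "y0 + s *\<^sub>R (y - y0) \<in> K"
      have "y = (1 - 1 / s) *\<^sub>R y0 + (1 / s) *\<^sub>R (y0 + s *\<^sub>R (y - y0))"
        using that by (simp add: algebra_simps)
      also have "\<dots> \<in> K" using that * by (intro convexD[OF K(2)] y0) auto
      finally show False using False by simp
    qed
    then have "indicator {1..2} s *\<^sub>R (s ^ DIM('a) *\<^sub>R G (y0 + s *\<^sub>R (y - y0))) = 0" for s
      by (auto simp: G_def indicator_def)
    then have "I y = 0" unfolding I_def by (intro integral_eq_zero_AE always_eventually allI)
    then show ?thesis using False by simp
  qed
  have "ennreal (norm (integral\<^sup>L lborel G)) = ennreal (norm (integral\<^sup>L lborel I))"
    using lborel_integral_dilation_average(2)[OF G, of y0] by (simp add: I_def[abs_def])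
  also have "\<dots> \<le> (\<integral>\<^sup>+y. norm (I y) \<partial>lborel)"
    using lborel_integral_dilation_average(1)[OF G, of y0] by (intro integral_norm_bound_ennreal) (simp add: I_def[abs_def])
  also have "\<dots> = (\<integral>\<^sup>+y. ennreal (norm (I y)) * indicator K y \<partial>lborel)"
    using Iy by (intro nn_integral_cong) (auto simp: indicator_def)
  also have "\<dots> \<le> ennreal (2 * M * C / (1 - 2 powr (\<alpha> - 1)) * \<bar>l\<bar> powr (- \<alpha>))"
  proof (rule nn_integral_sublevel_decay[where F = "\<lambda>y. indicator K y *\<^sub>R (f y - f y0)"])
    \<comment> \<open>The height above the minimum is cut off outside \<open>K\<close> because f is
      only known to be continuous there; on \<open>K\<close>, where the sublevel sets are taken,
      nothing changes.\<close>
    show "(\<lambda>y. indicator K y *\<^sub>R (f y - f y0)) \<in> borel_measurable lborel"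
    proof -
      have "continuous_on K (\<lambda>y. f y - f y0)" by (intro continuous_intros contf)
      then show ?thesis using borel_measurable_continuous_on_indicator[of K "\<lambda>y. f y - f y0"] by simp
    qed
    show "emeasure lborel {y \<in> space lborel. y \<in> K \<and> indicator K y *\<^sub>R (f y - f y0) \<le> s} \<le> ennreal (C * s powr \<alpha>)" if "s > 0" for s
    proof -
      have "{y \<in> space lborel. y \<in> K \<and> indicator K y *\<^sub>R (f y - f y0) \<le> s} = {y\<in>K. f y \<le> f y0 + s}" by auto
      then show ?thesis using sub[OF that] by simp
    qed
  qed (use Iy M_nonneg \<open>C \<ge> 0\<close> \<open>l \<noteq> 0\<close> \<open>\<alpha> < 1\<close> in auto)
  finally have "ennreal (norm (integral\<^sup>L lborel G)) \<le> \<dots>" .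
  moreover have "2 powr (\<alpha> - 1) < (1::real)" using \<open>\<alpha> < 1\<close> by (simp add: powr_less_one)
  moreover have "(\<integral>y. indicator K y *\<^sub>R (A y *\<^sub>R cis (l * f y)) \<partial>lborel) = integral\<^sup>L lborel G"
    unfolding G_def ..
  ultimately show ?thesis using M_nonneg \<open>C \<ge> 0\<close> by (subst (asm) ennreal_le_iff) auto
qed

subsection \<open>Decay of the Fourier transform\<close>

text \<open>A cut-off that is positive exactly on the ball of radius r > 0 about p. Squaring the
  positive part is enough to make it C1. It is not normalised; division by the sum over a covering
  is done later.\<close>

definition bump :: "'a::real_inner \<Rightarrow> real \<Rightarrow> 'a \<Rightarrow> real"
  where "bump p r x = (max 0 (r\<^sup>2 - (x - p) \<bullet> (x - p)))\<^sup>2"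

lemma DERIV_pos_part_square: "((\<lambda>u. (max 0 u)\<^sup>2) has_real_derivative 2 * max 0 x) (at (x::real))"
proof (cases x "0::real" rule: linorder_cases)
  case less
  have "((\<lambda>u. 0) has_real_derivative 2 * max 0 x) (at x)" using less by (auto intro!: derivative_eq_intros)
  then show ?thesis
    by (rule has_field_derivative_transform_within_open[of _ _ _ "{..<0}"]) (use less in auto)
next
  case greater
  have "((\<lambda>u. u\<^sup>2) has_real_derivative 2 * max 0 x) (at x)" using greater by (auto intro!: derivative_eq_intros)
  then show ?thesis
    by (rule has_field_derivative_transform_within_open[of _ _ _ "{0<..}"]) (use greater in auto)
next
  case equal
  have "((\<lambda>h. \<bar>h\<bar>) \<longlongrightarrow> \<bar>0\<bar>) (at (0::real))" by (intro tendsto_intros)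
  then have l: "((\<lambda>h::real. \<bar>h\<bar>) \<longlongrightarrow> 0) (at 0)" by simp
  have "((\<lambda>h. ((max 0 (0 + h))\<^sup>2 - (max 0 0)\<^sup>2) / h) \<longlongrightarrow> 0) (at (0::real))"
  proof (rule Lim_null_comparison[OF always_eventually l], rule allI)
    fix h :: real
    show "norm (((max 0 (0 + h))\<^sup>2 - (max 0 0)\<^sup>2) / h) \<le> \<bar>h\<bar>"
      by (cases "h \<le> 0") (auto simp: max_def power2_eq_square)
  qed
  then show ?thesis using equal by (simp add: DERIV_def)
qed

lemma C1_on_bump: "C1_on (bump p r) U"
proof -
  have 1: "C1_on (\<lambda>u::real. (max 0 u)\<^sup>2) UNIV"
    by (rule C1_on_real[OF DERIV_pos_part_square]) (intro continuous_intros)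
  have d: "C1_on (\<lambda>x. x + - p) U"
    by (intro C1_on_add C1_on_const C1_on_bounded_linear bounded_linear_ident)
  have "C1_on (\<lambda>x. r\<^sup>2 + (- 1) * ((x + - p) \<bullet> (x + - p))) U"
    by (intro C1_on_add C1_on_mult C1_on_const C1_on_bilinear[OF bounded_bilinear_inner d d])
  from C1_on_compose[OF this 1] show ?thesis by (simp add: bump_def[abs_def])
qed

lemma bump_nonneg: "bump p r x \<ge> 0"
  by (simp add: bump_def)

lemma bump_pos_iff: "r > 0 \<Longrightarrow> bump p r x > 0 \<longleftrightarrow> x \<in> ball p r"
proof -
  assume "r > 0"
  have "(x - p) \<bullet> (x - p) < r\<^sup>2 \<longleftrightarrow> norm (x - p) < r"
    using \<open>r > 0\<close> power_strict_mono[of "norm (x - p)" r 2] power2_less_imp_less[of "norm (x - p)" r]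
    by (auto simp: dot_square_norm)
  then show ?thesis by (auto simp: bump_def dist_norm norm_minus_commute zero_less_power2 max_def)
qed

lemma slab_le_slab_sup:
  assumes "s > 0"
  shows "emeasure \<nu> {x \<in> S. a \<le> x \<bullet> v \<and> x \<bullet> v \<le> a + s} \<le> slab_sup \<nu> S v (1 / s)"
  unfolding slab_sup_def using assms by (intro SUP_upper2[of a]) (auto simp: field_simps)

lemma slab_borel:
  fixes v :: "'a::euclidean_space"
  assumes "closed S"
  shows "{x \<in> S. a \<le> x \<bullet> v \<and> x \<bullet> v \<le> b} \<in> sets borel"
proof -
  have "{x \<in> S. a \<le> x \<bullet> v \<and> x \<bullet> v \<le> b} = S \<inter> {x. a \<le> x \<bullet> v} \<inter> {x. x \<bullet> v \<le> b}" by auto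
  moreover have "closed \<dots>"
    by (intro closed_Int assms closed_Collect_le continuous_intros)
  ultimately show ?thesis by simp
qed

lemma C2_on_inner: "C2_on \<Phi> V \<Longrightarrow> C2_on (\<lambda>y. w \<bullet> \<Phi> y) V"
  by (rule C2_on_linear_compose[OF bounded_linear_inner_right])

text \<open>The radius depends on the chart at p and is obtained before \<psi> and C, so that one
  finite covering serves all amplitudes, in particular amplitudes built from that covering.\<close>

lemma local_fourier_decay:
  fixes S :: "(real ^ ('n::finite + 1)) set"
  assumes S: "compact S" "C2_hypersurface S" "bounds_convex_domain S" and \<nu>: "surface_measure_on S \<nu>"
    and "\<alpha> < 1" and "p \<in> S"
  obtains r where "r > 0" "emeasure \<nu> (S \<inter> ball p r) < \<infinity>"
    "\<And>\<psi> C. C1_near \<psi> S \<Longrightarrow> C > 0 \<Longrightarrow>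
      (\<forall>v t. norm v = 1 \<and> t \<noteq> 0 \<longrightarrow> slab_sup \<nu> S v t \<le> ennreal (C * \<bar>t\<bar> powr (- \<alpha>))) \<Longrightarrow>
      \<exists>C'. \<forall>\<xi>. \<xi> \<noteq> 0 \<longrightarrow>
        norm (fourier_transform \<nu> S (\<lambda>x. bump p r x * \<psi> x) \<xi>) \<le> C' * norm \<xi> powr (- \<alpha>)"
proof -
  obtain \<Omega> where \<Omega>: "open \<Omega>" "convex \<Omega>" "S = frontier \<Omega>"
    using S(3) unfolding bounds_convex_domain_def by blast
  obtain U \<phi> where "C2_patch S U \<phi>" "p \<in> \<phi> ` U"
    using S(2) \<open>p \<in> S\<close> unfolding C2_hypersurface_def by blast
  from convex_graph_chart[OF \<Omega> this] obtain \<Phi> y0 R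
    where R: "R > 0" and patch: "C2_patch S (ball y0 R) \<Phi>" and \<Phi>y0: "\<Phi> y0 = p"
      and conv: "\<And>v. convex_on (ball y0 R) (\<lambda>y. v \<bullet> \<Phi> y) \<or> convex_on (ball y0 R) (\<lambda>y. - v \<bullet> \<Phi> y)"
    by metis
  define V where "V = ball y0 R"
  \<comment> \<open>Half the radius leaves a compact convex set inside the chart domain, on which
    the amplitude and its derivative are bounded and the area element is bounded below.\<close>
  define K where "K = cball y0 (R / 2)"
  note patch = patch[folded V_def] and conv = conv[folded V_def]
  have K: "compact K" "convex K" "K \<subseteq> V" "y0 \<in> K" using R by (auto simp: K_def V_def)
  have Kb [measurable]: "K \<in> sets borel" using K(1) borel_compact by blast
  have Sc: "closed S" using S(1) compact_imp_closed by blast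
  have V: "open V" "C2_on \<Phi> V" using patch by (auto simp: C2_patch_def)
  have \<Phi>c: "continuous_on V \<Phi>" using patch by (rule C2_patch_continuous_on)
  have \<Phi>S: "\<Phi> ` V \<subseteq> S" using C2_patch_image_borel[OF Sc patch] by simp
  obtain \<rho> where \<rho>: "homeomorphism V (\<Phi> ` V) \<Phi> \<rho>" using patch unfolding C2_patch_def by blast
  have inj: "inj_on \<Phi> V" using \<rho> by (intro inj_on_inverseI[of V \<rho>]) (simp add: homeomorphism_def)
  have op: "openin (top_of_set (\<Phi> ` V)) (\<Phi> ` ball y0 (R / 2))"
    by (rule homeomorphism_imp_open_map[OF \<rho>]) (use R in \<open>auto simp: V_def intro!: open_subset subset_ball\<close>)
  have "openin (top_of_set S) (\<Phi> ` ball y0 (R / 2))"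
    by (rule openin_trans[OF op]) (use patch in \<open>simp add: C2_patch_def\<close>)
  moreover have "p \<in> \<Phi> ` ball y0 (R / 2)" using \<Phi>y0 R by force
  ultimately obtain r where r: "r > 0" "ball p r \<inter> S \<subseteq> \<Phi> ` ball y0 (R / 2)"
    unfolding openin_contains_ball by blast
  have sub\<Phi>K: "S \<inter> ball p r \<subseteq> \<Phi> ` K" using r(2) by (force simp: K_def)
  have "emeasure \<nu> (S \<inter> ball p r) \<le> emeasure \<nu> (\<Phi> ` K)"
  proof (rule emeasure_mono[OF sub\<Phi>K])
    have "compact (\<Phi> ` K)" using K \<Phi>c compact_continuous_image continuous_on_subset by blast
    then show "\<Phi> ` K \<in> sets \<nu>" using surface_measure_on_sets[OF \<nu>] borel_compact by blast
  qed
  also have "\<dots> < \<infinity>" by (rule emeasure_surface_compact_finite[OF Sc \<nu> patch K(1,3)])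
  finally have fin: "emeasure \<nu> (S \<inter> ball p r) < \<infinity>" .
  have area: "C1_on (area_element \<Phi>) V" using patch by (rule C1_on_area_element)
  have "continuous_on K (area_element \<Phi>)"
    using C1_on_imp_continuous_on[OF area] K(3) continuous_on_subset by blast
  then obtain c where c: "c > 0" "\<And>y. y \<in> K \<Longrightarrow> c \<le> area_element \<Phi> y"
    using compact_pos_lower_bound[OF K(1)] area_element_pos[OF patch] K(3) by blast
  have "\<exists>C'. \<forall>\<xi>. \<xi> \<noteq> 0 \<longrightarrow>
        norm (fourier_transform \<nu> S (\<lambda>x. bump p r x * \<psi> x) \<xi>) \<le> C' * norm \<xi> powr (- \<alpha>)"
    if \<psi>: "C1_near \<psi> S" and C: "C > 0"
      and slab: "\<forall>v t. norm v = 1 \<and> t \<noteq> 0 \<longrightarrow> slab_sup \<nu> S v t \<le> ennreal (C * \<bar>t\<bar> powr (- \<alpha>))" for \<psi> C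
  proof -
    obtain N where N: "open N" "S \<subseteq> N" "C1_on \<psi> N" using \<psi> unfolding C1_near_def by blast
    define A where "A y = area_element \<Phi> y * (bump p r (\<Phi> y) * \<psi> (\<Phi> y))" for y
    have C1\<Phi>: "C1_on \<Phi> V" using V(2) by (rule C2_on_imp_C1_on)
    have A: "C1_on A V"
      unfolding A_def
      by (intro C1_on_mult area C1_on_compose[OF C1\<Phi> C1_on_bump[of p r N]] C1_on_compose[OF C1\<Phi> N(3)])
         (use \<Phi>S N(2) in auto)
    obtain A' where A': "\<And>x. x \<in> V \<Longrightarrow> (A has_derivative blinfun_apply (A' x)) (at x)" "continuous_on V A'"
      using A unfolding C1_on_def by blast
    obtain M0 where M0: "\<And>y. y \<in> K \<Longrightarrow> norm (A y) \<le> M0"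
      using compact_norm_upper_bound[OF K(1)] continuous_on_subset[OF C1_on_imp_continuous_on[OF A] K(3)] by metis
    obtain M1 where M1: "\<And>y. y \<in> K \<Longrightarrow> norm (A' y) \<le> M1"
      using compact_norm_upper_bound[OF K(1)] continuous_on_subset[OF A'(2) K(3)] by metis
    have M1': "onorm (frechet_derivative A (at y)) \<le> M1" if "y \<in> K" for y
      using M1[OF that] frechet_derivative_at[OF A'(1)[of y]] that K(3) by (auto simp: norm_blinfun.rep_eq)
    \<comment> \<open>The constant of \<open>convex_oscillatory_integral_bound\<close>, with R as
      the diameter of \<open>K\<close> and C / c as the sublevel constant after passing from surface
      measure to Lebesgue measure.\<close>
    define B where "B = 2 * (4 * (2 ^ DIM(real ^ 'n) * (DIM(real ^ 'n) * M0 + M0 + M1 * R))) * (C / c) / (1 - 2 powr (\<alpha> - 1))"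
    have "norm (fourier_transform \<nu> S (\<lambda>x. bump p r x * \<psi> x) \<xi>) \<le> B * norm \<xi> powr (- \<alpha>)" if "\<xi> \<noteq> 0" for \<xi>
    proof -
      define v where "v = \<xi> /\<^sub>R norm \<xi>"
      have "norm v = 1" "\<xi> = norm \<xi> *\<^sub>R v" using \<open>\<xi> \<noteq> 0\<close> by (auto simp: v_def)
      \<comment> \<open>One of v and -v makes the phase convex; the sign of \<open>l\<close>
        compensates, so that l w = - \<xi> matches the negative exponent of the transform.\<close>
      obtain w l where wl: "norm w = 1" "\<bar>l\<bar> = norm \<xi>" "l *\<^sub>R w = - \<xi>" "convex_on V (\<lambda>y. w \<bullet> \<Phi> y)"
      proof (cases "convex_on V (\<lambda>y. v \<bullet> \<Phi> y)")
        case True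
        then show thesis
          using \<open>norm v = 1\<close> \<open>\<xi> = norm \<xi> *\<^sub>R v\<close> by (intro that[of v "- norm \<xi>"]) auto
      next
        case False
        then show thesis
          using conv[of v] \<open>norm v = 1\<close> \<open>\<xi> = norm \<xi> *\<^sub>R v\<close> by (intro that[of "- v" "norm \<xi>"]) auto
      qed
      have "l \<noteq> 0" using wl(2) \<open>\<xi> \<noteq> 0\<close> by auto
      define f where "f y = w \<bullet> \<Phi> y" for y
      have f: "C2_on f V" "convex_on V f"
        using C2_on_inner[OF V(2), of w] wl(4) by (simp_all add: f_def[abs_def])
      have fcont: "continuous_on K f"
        using C1_on_imp_continuous_on[OF C2_on_imp_C1_on[OF f(1)]] K(3) continuous_on_subset by blast
      obtain z where z: "z \<in> K" "\<And>y. y \<in> K \<Longrightarrow> f z \<le> f y"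
        using continuous_attains_inf[OF K(1) _ fcont] K(4) by blast
      define h where "h x = indicator S x *\<^sub>R (exp (- (\<i> * complex_of_real (\<xi> \<bullet> x))) * complex_of_real (bump p r x * \<psi> x))" for x
      have "continuous_on S \<psi>" using C1_on_imp_continuous_on[OF N(3)] N(2) continuous_on_subset by blast
      then have hm: "h \<in> borel_measurable borel"
        unfolding h_def
        by (intro borel_measurable_continuous_on_indicator continuous_intros C1_on_imp_continuous_on[OF C1_on_bump])
           (use Sc in auto)
      have h0: "h x = 0" if "x \<notin> \<Phi> ` K" for x
      proof -
        have "x \<notin> S \<or> x \<notin> ball p r" using that sub\<Phi>K by blast
        then show ?thesis
          using bump_pos_iff[OF r(1), of p x] bump_nonneg[of p r x] by (auto simp: h_def indicator_def)
      qed
      have "fourier_transform \<nu> S (\<lambda>x. bump p r x * \<psi> x) \<xi> = integral\<^sup>L \<nu> h"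
        unfolding fourier_transform_def set_lebesgue_integral_def h_def ..
      also have "\<dots> = (\<integral>y. indicator V y *\<^sub>R (area_element \<Phi> y *\<^sub>R h (\<Phi> y)) \<partial>lborel)"
        using h0 K(3) by (intro surface_integral_patch[OF Sc \<nu> patch hm]) auto
      also have "\<dots> = (\<integral>y. indicator K y *\<^sub>R (A y *\<^sub>R cis (l * f y)) \<partial>lborel)"
      proof (intro Bochner_Integration.integral_cong refl)
        fix y
        have lf: "l * f y = - (\<xi> \<bullet> \<Phi> y)"
          using arg_cong[OF wl(3), of "\<lambda>u. u \<bullet> \<Phi> y"] by (simp add: f_def)
        have "h (\<Phi> y) = 0" if "y \<in> V" "y \<notin> K"
          using that inj K(3) by (intro h0) (auto simp: inj_on_def)
        moreover have "h (\<Phi> y) = (bump p r (\<Phi> y) * \<psi> (\<Phi> y)) *\<^sub>R cis (l * f y)" if "y \<in> V"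
          unfolding lf using that \<Phi>S by (auto simp: h_def cis_conv_exp scaleR_conv_of_real mult.commute)
        ultimately show "indicator V y *\<^sub>R (area_element \<Phi> y *\<^sub>R h (\<Phi> y)) = indicator K y *\<^sub>R (A y *\<^sub>R cis (l * f y))"
          using K(3) by (cases "y \<in> K"; cases "y \<in> V") (auto simp: A_def)
      qed
      finally have eq: "fourier_transform \<nu> S (\<lambda>x. bump p r x * \<psi> x) \<xi> = \<dots>" .
      \<comment> \<open>Since f z is the minimum over \<open>K\<close>, the chart maps the sublevel
        set into a slab of width s starting at height f z. A slab of width s corresponds to t = 1 /
        s, which turns the decay in t into growth s^\<alpha>.\<close>
      have sublevel: "emeasure lborel {y\<in>K. f y \<le> f z + s} \<le> ennreal (C / c * s powr \<alpha>)" if "s > 0" for s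
      proof -
        define E where "E = {y\<in>K. f y \<le> f z + s}"
        define X where "X = {x \<in> S. f z \<le> x \<bullet> w \<and> x \<bullet> w \<le> f z + s}"
        have "closed E"
          unfolding E_def by (intro continuous_on_closed_Collect_le fcont continuous_intros compact_imp_closed K)
        have "ennreal c * emeasure lborel E \<le> emeasure \<nu> X"
        proof (rule emeasure_chart_le[OF Sc \<nu> patch K(3) c])
          show "X \<in> sets borel" unfolding X_def by (rule slab_borel[OF Sc])
          show "E \<in> sets borel" using \<open>closed E\<close> by simp
          show "\<Phi> y \<in> X" if "y \<in> E" for y
            using that z(2)[of y] \<Phi>S K(3) by (auto simp: E_def X_def f_def inner_commute)
        qed (auto simp: E_def)
        also have "\<dots> \<le> slab_sup \<nu> S w (1 / s)" unfolding X_def by (rule slab_le_slab_sup[OF that])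
        also have "\<dots> \<le> ennreal (C * s powr \<alpha>)"
          using slab[rule_format, of w "1 / s"] wl(1) that by (simp add: powr_minus_divide powr_divide)
        finally have le: "ennreal c * emeasure lborel E \<le> ennreal (C * s powr \<alpha>)" .
        have "emeasure lborel E = ennreal (1 / c) * (ennreal c * emeasure lborel E)"
          using c(1) by (simp add: mult.assoc[symmetric] ennreal_mult[symmetric])
        also have "\<dots> \<le> ennreal (1 / c) * ennreal (C * s powr \<alpha>)" using le by (rule mult_left_mono) simp
        also have "\<dots> = ennreal (C / c * s powr \<alpha>)" using c(1) C by (simp add: ennreal_mult[symmetric])
        finally show ?thesis unfolding E_def .
      qed
      have "norm (fourier_transform \<nu> S (\<lambda>x. bump p r x * \<psi> x) \<xi>) \<le> B * \<bar>l\<bar> powr (- \<alpha>)"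
        unfolding eq B_def
      proof (rule convex_oscillatory_integral_bound[OF V(1) f A K(1-3) z \<open>l \<noteq> 0\<close> _ M1' _ _ \<open>\<alpha> < 1\<close> sublevel])
        show "norm (y - z) \<le> R" if "y \<in> K" for y
          using that z(1) dist_triangle2[of y z y0] by (simp add: K_def dist_norm norm_minus_commute)
      qed (use M0 C c in auto)
      then show ?thesis by (simp add: wl(2))
    qed
    then show ?thesis by blast
  qed
  then show thesis using r(1) fin that by blast
qed

section \<open>Patching the local estimates\<close>

lemma set_integrable_surface:
  fixes g :: "'a::euclidean_space \<Rightarrow> 'b::euclidean_space"
  assumes S: "compact S" and \<nu>: "sets \<nu> = sets borel" and fin: "emeasure \<nu> S < \<infinity>" and g: "continuous_on S g"
  shows "set_integrable \<nu> S g"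
proof -
  obtain B where B: "\<And>x. x \<in> S \<Longrightarrow> norm (g x) \<le> B" using compact_norm_upper_bound[OF S g] by blast
  have Sb: "S \<in> sets borel" using S borel_compact by blast
  show ?thesis
    unfolding set_integrable_def
  proof (rule integrableI_bounded_set[where A = S and B = B])
    show "(\<lambda>x. indicator S x *\<^sub>R g x) \<in> borel_measurable \<nu>"
      using borel_measurable_continuous_on_indicator[OF Sb g] measurable_cong_sets[OF \<nu> refl] by blast
  qed (use Sb \<nu> fin B in \<open>auto simp: indicator_def\<close>)
qed

lemma continuous_on_fourier_integrand:
  "continuous_on S \<psi> \<Longrightarrow> continuous_on S (\<lambda>x. exp (- (\<i> * complex_of_real (\<xi> \<bullet> x))) * complex_of_real (\<psi> x))"
  by (intro continuous_intros)

lemma C1_near_imp_continuous_on: "C1_near \<psi> S \<Longrightarrow> continuous_on S \<psi>"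
  unfolding C1_near_def using C1_on_imp_continuous_on continuous_on_subset by blast

text \<open>Compactness turns the pointwise radii into a finite covering chosen independently of
  \<psi>. Finiteness of the total measure is recorded here because it is also required in the
  converse direction.\<close>

lemma surface_measure_local_decay_cover:
  fixes S :: "(real ^ ('n::finite + 1)) set"
  assumes S: "compact S" "C2_hypersurface S" "bounds_convex_domain S" and \<nu>: "surface_measure_on S \<nu>"
    and "\<alpha> < 1"
  obtains F r where "finite F" "S \<subseteq> (\<Union>p\<in>F. ball p (r p))" "\<And>p. p \<in> F \<Longrightarrow> r p > 0" "emeasure \<nu> S < \<infinity>"
    "\<And>p \<psi> C. p \<in> F \<Longrightarrow> C1_near \<psi> S \<Longrightarrow> C > 0 \<Longrightarrow>
      (\<forall>v t. norm v = 1 \<and> t \<noteq> 0 \<longrightarrow> slab_sup \<nu> S v t \<le> ennreal (C * \<bar>t\<bar> powr (- \<alpha>))) \<Longrightarrow>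
      \<exists>C'. \<forall>\<xi>. \<xi> \<noteq> 0 \<longrightarrow>
        norm (fourier_transform \<nu> S (\<lambda>x. bump p (r p) x * \<psi> x) \<xi>) \<le> C' * norm \<xi> powr (- \<alpha>)"
proof -
  \<comment> \<open>The conclusion at one point as a predicate, so that the radii at all points can
    be chosen at once.\<close>
  define Q where "Q p r \<longleftrightarrow> r > 0 \<and> emeasure \<nu> (S \<inter> ball p r) < \<infinity> \<and>
    (\<forall>\<psi> C. C1_near \<psi> S \<longrightarrow> C > 0 \<longrightarrow>
      (\<forall>v t. norm v = 1 \<and> t \<noteq> 0 \<longrightarrow> slab_sup \<nu> S v t \<le> ennreal (C * \<bar>t\<bar> powr (- \<alpha>))) \<longrightarrow>
      (\<exists>C'. \<forall>\<xi>. \<xi> \<noteq> 0 \<longrightarrow>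
        norm (fourier_transform \<nu> S (\<lambda>x. bump p r x * \<psi> x) \<xi>) \<le> C' * norm \<xi> powr (- \<alpha>)))" for p r
  have "\<exists>r. Q p r" if p: "p \<in> S" for p
  proof (rule local_fourier_decay[OF S \<nu> \<open>\<alpha> < 1\<close> p])
    fix r
    assume "r > 0" "emeasure \<nu> (S \<inter> ball p r) < \<infinity>"
      and *: "\<And>\<psi> C. C1_near \<psi> S \<Longrightarrow> C > 0 \<Longrightarrow>
        (\<forall>v t. norm v = 1 \<and> t \<noteq> 0 \<longrightarrow> slab_sup \<nu> S v t \<le> ennreal (C * \<bar>t\<bar> powr (- \<alpha>))) \<Longrightarrow>
        \<exists>C'. \<forall>\<xi>. \<xi> \<noteq> 0 \<longrightarrow>
          norm (fourier_transform \<nu> S (\<lambda>x. bump p r x * \<psi> x) \<xi>) \<le> C' * norm \<xi> powr (- \<alpha>)"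
    then have "Q p r" unfolding Q_def by (intro conjI allI impI) (assumption, assumption, rule *)
    then show "\<exists>r. Q p r" ..
  qed
  then obtain r where r: "\<And>p. p \<in> S \<Longrightarrow> Q p (r p)" by metis
  have r_pos: "r p > 0" if "p \<in> S" for p using r[OF that] by (simp add: Q_def)
  then have "S \<subseteq> (\<Union>p\<in>S. ball p (r p))" by force
  then obtain F where F: "F \<subseteq> S" "finite F" "S \<subseteq> (\<Union>p\<in>F. ball p (r p))"
    using compactE_image[OF S(1), of S "\<lambda>p. ball p (r p)"] by auto
  have sb: "S \<inter> ball p (r p) \<in> sets \<nu>" for p
    unfolding surface_measure_on_sets[OF \<nu>] by (intro sets.Int borel_compact S(1) borel_open open_ball)
  have "emeasure \<nu> S \<le> emeasure \<nu> (\<Union>p\<in>F. S \<inter> ball p (r p))"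
    by (rule emeasure_mono[OF _ sets.finite_UN[OF F(2) sb]]) (use F(3) in blast)
  also have "\<dots> \<le> (\<Sum>p\<in>F. emeasure \<nu> (S \<inter> ball p (r p)))"
    using F sb by (intro emeasure_subadditive_finite) auto
  also have "\<dots> < \<infinity>"
  proof -
    have "emeasure \<nu> (S \<inter> ball p (r p)) < \<infinity>" if "p \<in> F" for p
      using r[of p] that F(1) by (auto simp: Q_def)
    then show ?thesis using F(2) by (simp add: less_top)
  qed
  finally have "emeasure \<nu> S < \<infinity>" .
  show thesis
  proof (rule that[OF F(2,3)])
    show "r p > 0" if "p \<in> F" for p
      using r_pos that F(1) by blast
    show "\<exists>C'. \<forall>\<xi>. \<xi> \<noteq> 0 \<longrightarrow>
        norm (fourier_transform \<nu> S (\<lambda>x. bump p (r p) x * \<psi> x) \<xi>) \<le> C' * norm \<xi> powr (- \<alpha>)"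
      if p: "p \<in> F" and *: "C1_near \<psi> S" "C > 0"
        "\<forall>v t. norm v = 1 \<and> t \<noteq> 0 \<longrightarrow> slab_sup \<nu> S v t \<le> ennreal (C * \<bar>t\<bar> powr (- \<alpha>))" for p \<psi> C
    proof -
      have "Q p (r p)" using r p F(1) by blast
      then show ?thesis unfolding Q_def using * by blast
    qed
  qed fact
qed

text \<open>The bumps do not sum to 1, so the local estimates are applied to \<psi> divided by their
  sum \<sigma>. Because \<sigma> is C1 and positive on an open neighbourhood of \<open>S\<close>,
  the quotient is again an admissible amplitude, and its products with the bumps add up to \<psi> on
  \<open>S\<close>.\<close>

lemma fourier_decay_of_slab_decay:
  fixes S :: "(real ^ ('n::finite + 1)) set"
  assumes S: "compact S" "C2_hypersurface S" "bounds_convex_domain S" and \<nu>: "surface_measure_on S \<nu>"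
    and "\<alpha> < 1" and \<psi>: "C1_near \<psi> S" and "C > 0"
    and slab: "\<forall>v t. norm v = 1 \<and> t \<noteq> 0 \<longrightarrow> slab_sup \<nu> S v t \<le> ennreal (C * \<bar>t\<bar> powr (- \<alpha>))"
  shows "\<exists>C'. \<forall>\<xi>. \<xi> \<noteq> 0 \<longrightarrow> norm (fourier_transform \<nu> S \<psi> \<xi>) \<le> C' * norm \<xi> powr (- \<alpha>)"
proof -
  obtain F r where F: "finite F" "S \<subseteq> (\<Union>p\<in>F. ball p (r p))" "\<And>p. p \<in> F \<Longrightarrow> r p > 0" "emeasure \<nu> S < \<infinity>"
    and dec: "\<And>p \<psi> C. p \<in> F \<Longrightarrow> C1_near \<psi> S \<Longrightarrow> C > 0 \<Longrightarrow>
      (\<forall>v t. norm v = 1 \<and> t \<noteq> 0 \<longrightarrow> slab_sup \<nu> S v t \<le> ennreal (C * \<bar>t\<bar> powr (- \<alpha>))) \<Longrightarrow>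
      \<exists>C'. \<forall>\<xi>. \<xi> \<noteq> 0 \<longrightarrow>
        norm (fourier_transform \<nu> S (\<lambda>x. bump p (r p) x * \<psi> x) \<xi>) \<le> C' * norm \<xi> powr (- \<alpha>)"
    by (rule surface_measure_local_decay_cover[OF S \<nu> \<open>\<alpha> < 1\<close>]) blast
  define W where "W = (\<Union>p\<in>F. ball p (r p))"
  define \<sigma> where "\<sigma> x = (\<Sum>p\<in>F. bump p (r p) x)" for x
  have \<sigma>_pos: "\<sigma> x > 0" if x: "x \<in> W" for x
  proof -
    obtain p where p: "p \<in> F" "x \<in> ball p (r p)" using x unfolding W_def by blast
    then have "bump p (r p) x > 0" using bump_pos_iff F(3) by blast
    then show ?thesis unfolding \<sigma>_def by (intro sum_pos2[OF F(1) p(1)] bump_nonneg)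
  qed
  obtain N where N: "open N" "S \<subseteq> N" "C1_on \<psi> N" using \<psi> unfolding C1_near_def by blast
  define \<psi>' where "\<psi>' x = inverse (\<sigma> x) * \<psi> x" for x
  have "C1_on \<sigma> (N \<inter> W)" unfolding \<sigma>_def by (intro C1_on_sum C1_on_bump)
  then have "C1_on (\<lambda>x. inverse (\<sigma> x)) (N \<inter> W)" by (rule C1_on_inverse) (use \<sigma>_pos in force)
  then have "C1_on \<psi>' (N \<inter> W)"
    unfolding \<psi>'_def by (rule C1_on_mult) (rule C1_on_subset[OF N(3)], simp)
  moreover have "open (N \<inter> W)" using N(1) by (auto simp: W_def)
  moreover have "S \<subseteq> N \<inter> W" using N(2) F(2) by (auto simp: W_def)
  ultimately have \<psi>': "C1_near \<psi>' S" unfolding C1_near_def by blast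
  have "\<forall>p\<in>F. \<exists>C'. \<forall>\<xi>. \<xi> \<noteq> 0 \<longrightarrow>
        norm (fourier_transform \<nu> S (\<lambda>x. bump p (r p) x * \<psi>' x) \<xi>) \<le> C' * norm \<xi> powr (- \<alpha>)"
    using dec[OF _ \<psi>' \<open>C > 0\<close> slab] by blast
  then obtain c where c: "\<And>p \<xi>. p \<in> F \<Longrightarrow> \<xi> \<noteq> 0 \<Longrightarrow>
        norm (fourier_transform \<nu> S (\<lambda>x. bump p (r p) x * \<psi>' x) \<xi>) \<le> c p * norm \<xi> powr (- \<alpha>)"
    by metis
  have "norm (fourier_transform \<nu> S \<psi> \<xi>) \<le> (\<Sum>p\<in>F. c p) * norm \<xi> powr (- \<alpha>)" if "\<xi> \<noteq> 0" for \<xi>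
  proof -
    let ?E = "\<lambda>x. exp (- (\<i> * complex_of_real (\<xi> \<bullet> x)))"
    have Sb: "S \<in> sets \<nu>" using S(1) surface_measure_on_sets[OF \<nu>] borel_compact by blast
    have int: "set_integrable \<nu> S (\<lambda>x. ?E x * complex_of_real (bump p (r p) x * \<psi>' x))" for p
      by (intro set_integrable_surface[OF S(1) surface_measure_on_sets[OF \<nu>] F(4)] continuous_on_fourier_integrand
          continuous_on_mult C1_on_imp_continuous_on[OF C1_on_bump] C1_near_imp_continuous_on[OF \<psi>'])
    have "fourier_transform \<nu> S \<psi> \<xi> = (LINT x:S|\<nu>. (\<Sum>p\<in>F. ?E x * complex_of_real (bump p (r p) x * \<psi>' x)))"
      unfolding fourier_transform_def
    proof (intro set_lebesgue_integral_cong Sb allI impI)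
      fix x assume "x \<in> S"
      then have "x \<in> W" using F(2) unfolding W_def by blast
      then have "\<sigma> x > 0" by (rule \<sigma>_pos)
      then have "\<psi> x = (\<Sum>p\<in>F. bump p (r p) x * \<psi>' x)"
        unfolding sum_distrib_right[symmetric] \<sigma>_def[symmetric] by (simp add: \<psi>'_def)
      then show "?E x * complex_of_real (\<psi> x) = (\<Sum>p\<in>F. ?E x * complex_of_real (bump p (r p) x * \<psi>' x))"
        by (simp only: of_real_sum sum_distrib_left)
    qed
    also have "\<dots> = (\<Sum>p\<in>F. fourier_transform \<nu> S (\<lambda>x. bump p (r p) x * \<psi>' x) \<xi>)"
      unfolding fourier_transform_def set_lebesgue_integral_def scaleR_sum_right
      by (rule Bochner_Integration.integral_sum) (use int in \<open>simp add: set_integrable_def\<close>)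
    also have "norm \<dots> \<le> (\<Sum>p\<in>F. c p * norm \<xi> powr (- \<alpha>))"
      by (rule sum_norm_le) (use c that in blast)
    finally show ?thesis by (simp add: sum_distrib_right)
  qed
  then show ?thesis by blast
qed

subsection \<open>Decay of slab measures\<close>

text \<open>Half the Fourier transform of the triangle function on [-1,1]: it equals (1 - cos u) /
  u^2 for u nonzero. The integral form is the one to which Fubini applies.\<close>

definition fejer_kernel :: "real \<Rightarrow> real"
  where "fejer_kernel u = (LINT \<tau>:{0..1}|lborel. (1 - \<tau>) * cos (\<tau> * u))"

lemma fejer_kernel_nonneg: "fejer_kernel u \<ge> 0"
proof (cases "u = 0")
  case True
  then show ?thesis
    unfolding fejer_kernel_def set_lebesgue_integral_def
    by (intro integral_nonneg_AE always_eventually) (auto simp: indicator_def)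
next
  case False
  \<comment> \<open>An antiderivative in \<tau> found by parts; its increment over [0,1] is (1 - cos
    u) / u^2, which is visibly nonnegative.\<close>
  define P where "P \<tau> = (1 - \<tau>) * sin (\<tau> * u) / u - cos (\<tau> * u) / u\<^sup>2" for \<tau>
  have "fejer_kernel u = P 1 - P 0"
    unfolding fejer_kernel_def set_lebesgue_integral_def
  proof (rule integral_FTC_atLeastAtMost)
    show "(P has_vector_derivative (1 - \<tau>) * cos (\<tau> * u)) (at \<tau> within {0..1})" for \<tau>
      unfolding P_def has_real_derivative_iff_has_vector_derivative[symmetric]
      using False by (auto intro!: derivative_eq_intros simp: field_simps power2_eq_square)
  qed (auto intro!: continuous_intros)
  also have "\<dots> = (1 - cos u) / u\<^sup>2" by (simp add: P_def diff_divide_distrib)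
  also have "\<dots> \<ge> 0" by simp
  finally show ?thesis .
qed

text \<open>For \<tau> in [0,1] the argument \<tau> u stays within pi/3 of 0, where the cosine is at
  least 1/2, and (1 - \<tau>)/2 integrates to 1/4.\<close>

lemma fejer_kernel_ge: "\<bar>u\<bar> \<le> 1 \<Longrightarrow> fejer_kernel u \<ge> 1 / 4"
proof -
  assume u: "\<bar>u\<bar> \<le> 1"
  have "(1 / 4 :: real) = (LINT \<tau>:{0..1}|lborel. (1 - \<tau>) / 2)"
  proof -
    have "(LINT \<tau>:{0..1}|lborel. (1 - \<tau>) / 2) = (1 / 2 - 1\<^sup>2 / 4) - (0 / 2 - 0\<^sup>2 / (4::real))"
      unfolding set_lebesgue_integral_def
      by (rule integral_FTC_atLeastAtMost)
         (auto intro!: continuous_intros derivative_eq_intros simp: has_real_derivative_iff_has_vector_derivative[symmetric] field_simps)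
    then show ?thesis by simp
  qed
  also have "\<dots> \<le> fejer_kernel u"
    unfolding fejer_kernel_def
  proof (rule set_integral_mono)
    fix \<tau> :: real assume \<tau>: "\<tau> \<in> {0..1}"
    have "\<bar>\<tau> * u\<bar> \<le> 1" unfolding abs_mult using \<tau> u by (intro mult_le_one) auto
    also have "1 \<le> pi / 3" using pi_gt3 by simp
    finally have "cos (pi / 3) \<le> cos \<bar>\<tau> * u\<bar>" by (intro cos_monotone_0_pi_le) auto
    then have "1 / 2 \<le> cos (\<tau> * u)" by (simp add: cos_60)
    then have "(1 - \<tau>) * (1 / 2) \<le> (1 - \<tau>) * cos (\<tau> * u)" using \<tau> by (intro mult_left_mono) auto
    then show "(1 - \<tau>) / 2 \<le> (1 - \<tau>) * cos (\<tau> * u)" by simp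
  qed (auto intro!: borel_integrable_atLeastAtMost' continuous_intros)
  finally show "fejer_kernel u \<ge> 1 / 4" .
qed

lemma slab_decay_of_fourier_decay:
  fixes S :: "'a::euclidean_space set"
  assumes S: "compact S" and \<nu>: "sets \<nu> = sets borel" "emeasure \<nu> (- S) = 0" "emeasure \<nu> S < \<infinity>"
    and \<psi>: "continuous_on S \<psi>" "\<And>x. x \<in> S \<Longrightarrow> \<psi> x > 0"
    and \<alpha>: "0 < \<alpha>" "\<alpha> < 1"
    and decay: "\<And>\<xi>. \<xi> \<noteq> 0 \<Longrightarrow> norm (fourier_transform \<nu> S \<psi> \<xi>) \<le> C' * norm \<xi> powr (- \<alpha>)"
  shows "\<exists>C>0. \<forall>v t. norm v = 1 \<and> t \<noteq> 0 \<longrightarrow> slab_sup \<nu> S v t \<le> ennreal (C * \<bar>t\<bar> powr (- \<alpha>))"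
proof -
  obtain c where c: "c > 0" "\<And>x. x \<in> S \<Longrightarrow> c \<le> \<psi> x"
    using compact_pos_lower_bound[OF S \<psi>] by blast
  obtain e0 :: 'a where "e0 \<in> Basis" using nonempty_Basis by blast
  then have "C' \<ge> 0"
    using order_trans[OF norm_ge_zero decay[of e0]] by (auto simp: nonzero_Basis)
  have Sb [measurable]: "S \<in> sets borel" using S borel_compact by blast
  note [measurable_cong] = \<nu>(1)
  have sp: "space \<nu> = UNIV" using sets_eq_imp_space_eq[OF \<nu>(1)] by simp
  \<comment> \<open>Since \<nu> is carried by \<open>S\<close>, finiteness on \<open>S\<close> is
    finiteness on the whole space, as the product with Lebesgue measure requires.\<close>
  have "emeasure \<nu> (S \<union> - S) \<le> emeasure \<nu> S + emeasure \<nu> (- S)"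
    using Sb \<nu>(1) by (intro emeasure_subadditive) auto
  then have "emeasure \<nu> (space \<nu>) \<le> emeasure \<nu> S" by (simp add: sp \<nu>(2))
  then have fin: "emeasure \<nu> (space \<nu>) < \<infinity>" using \<nu>(3) by (rule order_le_less_trans)
  interpret finite_measure \<nu> by (rule finite_measureI) (use fin in simp)
  interpret PS: pair_sigma_finite lborel \<nu> ..
  define \<psi>S where "\<psi>S x = indicator S x *\<^sub>R \<psi> x" for x
  have [measurable]: "\<psi>S \<in> borel_measurable borel"
    unfolding \<psi>S_def by (rule borel_measurable_continuous_on_indicator[OF Sb \<psi>(1)])
  obtain B where B: "B > 0" "\<And>x. x \<in> S \<Longrightarrow> norm (\<psi> x) \<le> B" using compact_norm_upper_bound[OF S \<psi>(1)] by blast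
  have \<psi>S_le: "norm (\<psi>S x) \<le> B" and \<psi>S_nonneg: "\<psi>S x \<ge> 0" for x
    using B(1) B(2)[of x] \<psi>(2)[of x] by (auto simp: \<psi>S_def indicator_def less_imp_le)
  \<comment> \<open>The 4 inverts the lower bound of the kernel, c is the minimum bound for \<psi>,
    and 1 / (1 - \<alpha>) is the integral of \<tau>^(-\<alpha>) over [0,1].\<close>
  define D where "D = 4 * C' / (c * (1 - \<alpha>))"
  have "D \<ge> 0" using \<open>C' \<ge> 0\<close> c \<alpha> by (simp add: D_def)
  have main: "emeasure \<nu> {x \<in> S. s \<le> x \<bullet> v \<and> x \<bullet> v \<le> s + \<delta>} \<le> ennreal (D * \<delta> powr \<alpha>)"
    if v: "norm v = 1" and \<delta>: "\<delta> > 0" for v s \<delta>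
  proof -
    define X where "X = {x \<in> S. s \<le> x \<bullet> v \<and> x \<bullet> v \<le> s + \<delta>}"
    have X: "X \<in> sets \<nu>" unfolding X_def \<nu>(1) by (rule slab_borel[OF compact_imp_closed[OF S]])
    \<comment> \<open>Rescales the slab to 0 \<le> u \<le> 1, inside the range where the kernel is
      at least 1/4.\<close>
    define u where "u x = (x \<bullet> v - s) / \<delta>" for x
    have [measurable]: "u \<in> borel_measurable borel" unfolding u_def by measurable
    define f where "f \<tau> x = indicator {0..1} \<tau> *\<^sub>R ((1 - \<tau>) * cos (\<tau> * u x)) * \<psi>S x" for \<tau> :: real and x
    have fm: "(\<lambda>(\<tau>, x). f \<tau> x) \<in> borel_measurable (lborel \<Otimes>\<^sub>M \<nu>)"
      unfolding f_def by measurable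
    have int: "integrable (lborel \<Otimes>\<^sub>M \<nu>) (\<lambda>(\<tau>, x). f \<tau> x)"
    proof (rule integrableI_bounded_set[where A = "{0..1::real} \<times> space \<nu>" and B = B])
      show "emeasure (lborel \<Otimes>\<^sub>M \<nu>) ({0..1::real} \<times> space \<nu>) < \<infinity>"
        using fin by (subst emeasure_pair_measure_Times) (auto simp: ennreal_mult_less_top)
      show "AE z in lborel \<Otimes>\<^sub>M \<nu>. z \<in> {0..1} \<times> space \<nu> \<longrightarrow> norm (case z of (\<tau>, x) \<Rightarrow> f \<tau> x) \<le> B"
      proof (intro always_eventually allI impI)
        fix z :: "real \<times> 'a" assume "z \<in> {0..1} \<times> space \<nu>"
        then obtain \<tau> x where z: "z = (\<tau>, x)" "\<tau> \<in> {0..1}" by auto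
        have "norm (f \<tau> x) = (\<bar>1 - \<tau>\<bar> * \<bar>cos (\<tau> * u x)\<bar>) * norm (\<psi>S x)"
          using z(2) by (simp add: f_def abs_mult)
        also have "\<dots> \<le> 1 * B"
          using z(2) \<psi>S_le by (intro mult_mono mult_le_one) auto
        finally show "norm (case z of (\<tau>, x) \<Rightarrow> f \<tau> x) \<le> B" by (simp add: z)
      qed
      show "AE z in lborel \<Otimes>\<^sub>M \<nu>. z \<notin> {0..1} \<times> space \<nu> \<longrightarrow> (case z of (\<tau>, x) \<Rightarrow> f \<tau> x) = 0"
        by (rule always_eventually) (auto simp: f_def sp indicator_def)
    qed (simp, rule fm)
    have kx: "(\<integral>\<tau>. f \<tau> x \<partial>lborel) = fejer_kernel (u x) * \<psi>S x" for x
      unfolding f_def fejer_kernel_def set_lebesgue_integral_def by (rule integral_mult_left_zero)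
    have k_int: "integrable \<nu> (\<lambda>x. fejer_kernel (u x) * \<psi>S x)"
      using PS.integrable_snd[OF int] by (simp add: kx)
    have inner: "norm (\<integral>x. f \<tau> x \<partial>\<nu>) \<le> C' * (\<tau> / \<delta>) powr (- \<alpha>)" if \<tau>: "0 < \<tau>" "\<tau> \<le> 1" for \<tau>
    proof -
      define \<xi> where "\<xi> = (\<tau> / \<delta>) *\<^sub>R v"
      have n\<xi>: "norm \<xi> = \<tau> / \<delta>" using \<tau> \<delta> v by (simp add: \<xi>_def)
      have "set_integrable \<nu> S (\<lambda>x. exp (- (\<i> * complex_of_real (\<xi> \<bullet> x))) * complex_of_real (\<psi> x))"
        by (rule set_integrable_surface[OF S \<nu>(1,3) continuous_on_fourier_integrand[OF \<psi>(1)]])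
      then have i: "integrable \<nu> (\<lambda>x. cis (\<tau> * s / \<delta>) * (indicator S x *\<^sub>R (exp (- (\<i> * complex_of_real (\<xi> \<bullet> x))) * complex_of_real (\<psi> x))))"
        unfolding set_integrable_def by (rule integrable_mult_right)
      \<comment> \<open>The unimodular factor moves the phase origin to the edge of the slab: with
        \<xi> = (\<tau> / \<delta>) v the total phase is - \<tau> u(x). It does not change the
        modulus of the transform, so the bound is independent of s.\<close>
      have pt: "f \<tau> x = (1 - \<tau>) * Re (cis (\<tau> * s / \<delta>) * (indicator S x *\<^sub>R (exp (- (\<i> * complex_of_real (\<xi> \<bullet> x))) * complex_of_real (\<psi> x))))" for x
      proof -
        have "cis (\<tau> * s / \<delta>) * exp (- (\<i> * complex_of_real (\<xi> \<bullet> x))) = cis (- (\<tau> * u x))"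
          unfolding cis_conv_exp exp_add[symmetric]
          by (rule arg_cong[of _ _ exp]) (use \<delta> in \<open>simp add: \<xi>_def u_def inner_commute field_simps\<close>)
        then have "cis (\<tau> * s / \<delta>) * (indicator S x *\<^sub>R (exp (- (\<i> * complex_of_real (\<xi> \<bullet> x))) * complex_of_real (\<psi> x)))
            = \<psi>S x *\<^sub>R cis (- (\<tau> * u x))"
          by (auto simp: \<psi>S_def indicator_def scaleR_conv_of_real algebra_simps)
        then show ?thesis using \<tau> by (simp add: f_def)
      qed
      have "(\<integral>x. f \<tau> x \<partial>\<nu>) = (1 - \<tau>) * Re (cis (\<tau> * s / \<delta>) * fourier_transform \<nu> S \<psi> \<xi>)"
        unfolding pt fourier_transform_def set_lebesgue_integral_def
        by (simp only: integral_mult_right_zero integral_Re[OF i])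
      also have "norm \<dots> \<le> 1 * norm (cis (\<tau> * s / \<delta>) * fourier_transform \<nu> S \<psi> \<xi>)"
        unfolding real_norm_def abs_mult using \<tau> by (intro mult_mono abs_Re_le_cmod) auto
      also have "\<dots> = norm (fourier_transform \<nu> S \<psi> \<xi>)" by (simp add: norm_mult)
      also have "\<dots> \<le> C' * (\<tau> / \<delta>) powr (- \<alpha>)"
        using decay[of \<xi>] n\<xi> \<tau> \<delta> by fastforce
      finally show ?thesis .
    qed
    have "((\<lambda>\<tau>. \<tau> powr (- \<alpha>)) has_integral (1 powr (- \<alpha> + 1) / (- \<alpha> + 1))) {0..1}"
      using \<alpha> by (intro has_integral_powr_from_0) auto
    from has_integral_mult_right[OF this, of "C' * \<delta> powr \<alpha>"]
    have hi: "((\<lambda>\<tau>. C' * \<delta> powr \<alpha> * \<tau> powr (- \<alpha>)) has_integral (C' * \<delta> powr \<alpha> / (1 - \<alpha>))) {0..1}" by simp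
    have "(\<lambda>\<tau>. indicator {0..1} \<tau> * (C' * \<delta> powr \<alpha> * \<tau> powr (- \<alpha>)))
        = (\<lambda>\<tau>. if \<tau> \<in> {0..1} then C' * \<delta> powr \<alpha> * \<tau> powr (- \<alpha>) else 0)"
      by (auto simp: indicator_def)
    with hi have hi_UNIV: "((\<lambda>\<tau>. indicator {0..1} \<tau> * (C' * \<delta> powr \<alpha> * \<tau> powr (- \<alpha>)))
        has_integral (C' * \<delta> powr \<alpha> / (1 - \<alpha>))) UNIV"
      by (simp only: has_integral_restrict_UNIV)
    have "ennreal (\<integral>x. fejer_kernel (u x) * \<psi>S x \<partial>\<nu>) = ennreal (\<integral>\<tau>. \<integral>x. f \<tau> x \<partial>\<nu> \<partial>lborel)"
      using PS.Fubini_integral[OF int] by (simp add: kx)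
    also have "\<dots> \<le> ennreal (norm (\<integral>\<tau>. \<integral>x. f \<tau> x \<partial>\<nu> \<partial>lborel))" by (intro ennreal_leI) simp
    also have "\<dots> \<le> (\<integral>\<^sup>+\<tau>. norm (\<integral>x. f \<tau> x \<partial>\<nu>) \<partial>lborel)"
      using PS.integrable_fst[OF int] by (rule integral_norm_bound_ennreal)
    also have "\<dots> \<le> (\<integral>\<^sup>+\<tau>. ennreal (indicator {0..1} \<tau> * (C' * \<delta> powr \<alpha> * \<tau> powr (- \<alpha>))) \<partial>lborel)"
    proof (rule nn_integral_mono_AE)
      show "AE \<tau> in lborel. ennreal (norm (\<integral>x. f \<tau> x \<partial>\<nu>)) \<le> ennreal (indicator {0..1} \<tau> * (C' * \<delta> powr \<alpha> * \<tau> powr (- \<alpha>)))"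
        \<comment> \<open>At \<tau> = 0 the frequency vanishes and the decay hypothesis gives
          nothing; this single point is discarded.\<close>
        using AE_lborel_singleton[of "0::real"]
      proof eventually_elim
        case (elim \<tau>)
        show ?case
        proof (cases "\<tau> \<in> {0..1}")
          case True
          then have "(\<tau> / \<delta>) powr (- \<alpha>) = \<delta> powr \<alpha> * \<tau> powr (- \<alpha>)"
            using \<delta> by (simp add: powr_divide powr_minus_divide)
          then show ?thesis using inner[of \<tau>] True elim by (intro ennreal_leI) (simp add: mult.assoc)
        qed (simp add: f_def)
      qed
    qed
    also have "\<dots> = ennreal (C' * \<delta> powr \<alpha> / (1 - \<alpha>))"
      using \<open>C' \<ge> 0\<close> by (intro nn_integral_has_integral_lborel hi_UNIV) auto
    finally have upper: "(\<integral>x. fejer_kernel (u x) * \<psi>S x \<partial>\<nu>) \<le> C' * \<delta> powr \<alpha> / (1 - \<alpha>)"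
      using \<open>C' \<ge> 0\<close> \<alpha> by (subst (asm) ennreal_le_iff) auto
    have "c / 4 * measure \<nu> X = (\<integral>x. c / 4 * indicator X x \<partial>\<nu>)" using X by simp
    also have "\<dots> \<le> (\<integral>x. fejer_kernel (u x) * \<psi>S x \<partial>\<nu>)"
    proof (rule integral_mono[OF _ k_int])
      show "integrable \<nu> (\<lambda>x. c / 4 * indicator X x)" using X by (intro integrable_mult_right integrable_real_indicator) (auto simp: emeasure_eq_measure)
      show "c / 4 * indicator X x \<le> fejer_kernel (u x) * \<psi>S x" for x
      proof (cases "x \<in> X")
        case True
        then have "\<bar>u x\<bar> \<le> 1" using \<delta> by (auto simp: X_def u_def abs_le_iff field_simps)
        then have "1 / 4 * c \<le> fejer_kernel (u x) * \<psi> x"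
          using fejer_kernel_ge[of "u x"] c True by (intro mult_mono) (auto simp: X_def)
        then show ?thesis using True by (simp add: \<psi>S_def X_def)
      qed (simp add: fejer_kernel_nonneg \<psi>S_nonneg)
    qed
    also note upper
    finally have "measure \<nu> X \<le> D * \<delta> powr \<alpha>"
      using c \<alpha> by (simp add: D_def field_simps)
    then show ?thesis unfolding X_def[symmetric] emeasure_eq_measure by (rule ennreal_leI)
  qed
  \<comment> \<open>\<open>D\<close> is 0 when C' is, whereas the constant sought must be positive;
    hence D + 1.\<close>
  have "slab_sup \<nu> S v t \<le> ennreal ((D + 1) * \<bar>t\<bar> powr (- \<alpha>))" if "norm v = 1" "t \<noteq> 0" for v t
    unfolding slab_sup_def
  proof (rule SUP_least)
    fix s
    have "emeasure \<nu> {x \<in> S. s \<le> x \<bullet> v \<and> x \<bullet> v \<le> s + inverse \<bar>t\<bar>} \<le> ennreal (D * inverse \<bar>t\<bar> powr \<alpha>)"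
      using that by (intro main) auto
    also have "\<dots> \<le> ennreal ((D + 1) * \<bar>t\<bar> powr (- \<alpha>))"
      using that by (intro ennreal_leI) (simp add: powr_minus inverse_powr distrib_right)
    finally show "emeasure \<nu> {x \<in> S. s \<le> x \<bullet> v \<and> x \<bullet> v \<le> s + inverse \<bar>t\<bar>} \<le> ennreal ((D + 1) * \<bar>t\<bar> powr (- \<alpha>))" .
  qed
  then show ?thesis using \<open>D \<ge> 0\<close> by (intro exI[of _ "D + 1"]) auto
qed

theorem theorem1p4:
  fixes S :: "(real ^ ('n::finite + 1)) set"
    and \<nu> :: "(real ^ ('n + 1)) measure"
    and \<alpha> :: real
  assumes "compact S"
    and "C2_hypersurface S"
    and "bounds_convex_domain S"
    and "surface_measure_on S \<nu>"
    and "0 < \<alpha>" "\<alpha> < 1"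
  shows
    "(\<forall>\<psi>. C1_near \<psi> S \<longrightarrow>
      (\<exists>C>0. \<forall>v t. norm v = 1 \<and> t \<noteq> 0 \<longrightarrow>
        slab_sup \<nu> S v t \<le> ennreal (C * \<bar>t\<bar> powr (- \<alpha>))) \<longrightarrow>
      (\<exists>C'. \<forall>\<xi>. \<xi> \<noteq> 0 \<longrightarrow>
        norm (fourier_transform \<nu> S \<psi> \<xi>) \<le> C' * norm \<xi> powr (- \<alpha>))) \<and>
     (\<exists>C>0. \<forall>\<psi>. C1_near \<psi> S \<and> (\<forall>x\<in>S. \<psi> x > 0) \<longrightarrow>
      (\<exists>C'. \<forall>\<xi>. \<xi> \<noteq> 0 \<longrightarrow>
        norm (fourier_transform \<nu> S \<psi> \<xi>) \<le> C' * norm \<xi> powr (- \<alpha>)) \<longrightarrow>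
      (\<forall>v t. norm v = 1 \<and> t \<noteq> 0 \<longrightarrow>
        slab_sup \<nu> S v t \<le> ennreal (C * \<bar>t\<bar> powr (- \<alpha>))))"
proof
  show "\<forall>\<psi>. C1_near \<psi> S \<longrightarrow>
      (\<exists>C>0. \<forall>v t. norm v = 1 \<and> t \<noteq> 0 \<longrightarrow>
        slab_sup \<nu> S v t \<le> ennreal (C * \<bar>t\<bar> powr (- \<alpha>))) \<longrightarrow>
      (\<exists>C'. \<forall>\<xi>. \<xi> \<noteq> 0 \<longrightarrow>
        norm (fourier_transform \<nu> S \<psi> \<xi>) \<le> C' * norm \<xi> powr (- \<alpha>))"
    using fourier_decay_of_slab_decay[OF assms(1-4) \<open>\<alpha> < 1\<close>] by blast
  have sets: "sets \<nu> = sets borel" and null: "emeasure \<nu> (- S) = 0"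
    using assms(4) by (auto simp: surface_measure_on_def)
  have fin: "emeasure \<nu> S < \<infinity>"
    by (rule surface_measure_local_decay_cover[OF assms(1-4) \<open>\<alpha> < 1\<close>])
  \<comment> \<open>The constant precedes the quantifier over \<psi>. The slab estimate does not
    mention \<psi>, so a constant obtained from one admissible \<psi> with decay serves for all of
    them; if there is none, the implication is vacuous and C = 1 will do.\<close>
  show "\<exists>C>0. \<forall>\<psi>. C1_near \<psi> S \<and> (\<forall>x\<in>S. \<psi> x > 0) \<longrightarrow>
      (\<exists>C'. \<forall>\<xi>. \<xi> \<noteq> 0 \<longrightarrow>
        norm (fourier_transform \<nu> S \<psi> \<xi>) \<le> C' * norm \<xi> powr (- \<alpha>)) \<longrightarrow>
      (\<forall>v t. norm v = 1 \<and> t \<noteq> 0 \<longrightarrow>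
        slab_sup \<nu> S v t \<le> ennreal (C * \<bar>t\<bar> powr (- \<alpha>)))"
  proof (cases "\<exists>\<psi> C'. C1_near \<psi> S \<and> (\<forall>x\<in>S. \<psi> x > 0) \<and>
        (\<forall>\<xi>. \<xi> \<noteq> 0 \<longrightarrow> norm (fourier_transform \<nu> S \<psi> \<xi>) \<le> C' * norm \<xi> powr (- \<alpha>))")
    case True
    then obtain \<psi> C' where \<psi>: "C1_near \<psi> S" "\<And>x. x \<in> S \<Longrightarrow> \<psi> x > 0"
      "\<And>\<xi>. \<xi> \<noteq> 0 \<Longrightarrow> norm (fourier_transform \<nu> S \<psi> \<xi>) \<le> C' * norm \<xi> powr (- \<alpha>)" by blast
    from slab_decay_of_fourier_decay[OF assms(1) sets null fin C1_near_imp_continuous_on[OF \<psi>(1)] \<psi>(2) assms(5,6) \<psi>(3)]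
    show ?thesis by blast
  next
    case False
    then show ?thesis by (intro exI[of _ "1 :: real"] conjI zero_less_one) blast
  qed
qed

end
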